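(* Let $(X(t),Y(t))$ be the planar random motion with direction process $D(t)$ defined in the context, with Poisson rate $\lambda$, speed $c$ and turning probabilities $p$ (counterclockwise), $q$ (clockwise), $1-p-q$ (reflection), and let $T(t)=\int_0^t\mathbf{1}_{\{D(\tau)\in\{d_1,d_3\}\}}\,d\tau$. Let $\bar g(y,t)$ be the density defined by $\bar g(y,t)\,dy=\mathbb{P}\big(Y(t)\in dy,\ T(t)=t\big)$, $|y|<ct$. If $p+q<1$, then $$\bar g(y,t)=\frac{e^{-\lambda t}}{4c}\left[\lambda(1-p-q)\,I_0\left(\frac{\lambda}{c}(1-p-q)\sqrt{c^2t^2-y^2}\right)+\frac{\partial}{\partial t}I_0\left(\frac{\lambda}{c}(1-p-q)\sqrt{c^2t^2-y^2}\right)\right],\qquad|y|<ct,$$ where $I_0$ is the modified Bessel function of the first kind of order $0$, and $$\begin{aligned}\mathbb{E}\left[e^{i\beta Y(t)}\,\mathbf{1}_{\{T(t)=t\}}\right]=\frac{e^{-\lambda t}}{4}\Bigg[&\left(1+\frac{\lambda(1-p-q)}{\sqrt{\lambda^2(1-p-q)^2-\beta^2c^2}}\right)e^{t\sqrt{\lambda^2(1-p-q)^2-\beta^2c^2}}\\&+\left(1-\frac{\lambda(1-p-q)}{\sqrt{\lambda^2(1-p-q)^2-\beta^2c^2}}\right)e^{-t\sqrt{\lambda^2(1-p-q)^2-\beta^2c^2}}\Bigg].\end{aligned}$$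
   Context: Model. Let $d_j=(\cos(\pi j/2),\sin(\pi j/2))$, with index $j$ taken modulo 4. Let $N(t)$ be a homogeneous Poisson process of rate $\lambda$. The direction process $D(t)$ takes values in $\{d_0,d_1,d_2,d_3\}$; $D(0)$ is uniformly distributed; $D$ is constant between Poisson events; at each Poisson event $D$ jumps from its current value $d_j$ to $d_{j+1}$ with probability $p$ (counterclockwise turn), to $d_{j-1}$ with probability $q$ (clockwise turn), and to $d_{j+2}$ with probability $1-p-q$ (reflection); the initial direction, the Poisson process and the successive choices of turn are independent. The motion starts at the origin and has speed $c$: $(X(t),Y(t))=c\int_0^t D(\tau)\,d\tau$. The event $T(t)=t$ means that the motion has always been vertical, i.e. $(T(t),Y(t))$ lies on the vertical side of its triangular support $\{(s,y):|y|\le cs,\ s\in[0,t]\}$. Square roots of negative real numbers are complex square roots. *)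

theory Defs
  imports "HOL-Probability.Probability"
begin

definition bessel_I :: "nat \<Rightarrow> real \<Rightarrow> real" where
  "bessel_I n z = (\<Sum>k. (z / 2) ^ (2 * k + n) / (fact k * fact (k + n)))"

text \<open>
  A homogeneous Poisson process as a right-continuous counting process with stationary and
  independent Poisson increments. The path properties are required on the whole of \<open>space M\<close>, so
  that path integrals are random variables even when \<open>M\<close> is not complete. Only times \<open>t \<ge> 0\<close> matter.
\<close>

locale poisson_process = prob_space M
  for M :: "'a measure" and N :: "real \<Rightarrow> 'a \<Rightarrow> nat" and lambda :: real +
  assumes rate_pos: "lambda > 0"
    and N_random_variable: "\<And>t. t \<ge> 0 \<Longrightarrow> random_variable (count_space UNIV) (N t)"
    and N_zero: "\<And>\<omega>. \<omega> \<in> space M \<Longrightarrow> N 0 \<omega> = 0"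
    and N_mono: "\<And>\<omega> s t. \<omega> \<in> space M \<Longrightarrow> 0 \<le> s \<Longrightarrow> s \<le> t \<Longrightarrow> N s \<omega> \<le> N t \<omega>"
    and N_right_continuous:
      "\<And>\<omega> t. \<omega> \<in> space M \<Longrightarrow> 0 \<le> t \<Longrightarrow> eventually (\<lambda>s. N s \<omega> = N t \<omega>) (at_right t)"
    and N_increment_distr:
      "\<And>s t. 0 \<le> s \<Longrightarrow> s < t \<Longrightarrow>
         distr M (count_space UNIV) (\<lambda>\<omega>. N t \<omega> - N s \<omega>)
           = measure_pmf (poisson_pmf (lambda * (t - s)))"
    and N_indep_increments:
      "\<And>(\<tau> :: nat \<Rightarrow> real) n. 0 \<le> \<tau> 0 \<Longrightarrow> (\<forall>i<n. \<tau> i \<le> \<tau> (Suc i)) \<Longrightarrow>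
         indep_vars (\<lambda>_. count_space UNIV) (\<lambda>i \<omega>. N (\<tau> (Suc i)) \<omega> - N (\<tau> i) \<omega>) {..<n}"

definition dir :: "int \<Rightarrow> real \<times> real" where
  "dir j = (cos (pi * of_int j / 2), sin (pi * of_int j / 2))"

text \<open>
  The direction process is driven by the index \<open>J0\<close> of the initial direction, the process \<open>N\<close> and
  the successive turns \<open>\<xi> 0, \<xi> 1, \<dots>\<close>: the \<open>n\<close>-th Poisson event adds \<open>\<xi> (n - 1)\<close> to the index,
  the values \<open>1\<close>, \<open>-1\<close> and \<open>2\<close> being a counterclockwise turn, a clockwise turn and a reflection.
  Indices need not be reduced modulo 4, since \<open>dir\<close> has period 4.
\<close>

definition direction ::
  "('a \<Rightarrow> int) \<Rightarrow> (real \<Rightarrow> 'a \<Rightarrow> nat) \<Rightarrow> (nat \<Rightarrow> 'a \<Rightarrow> int) \<Rightarrow> real \<Rightarrow> 'a \<Rightarrow> real \<times> real" where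
  "direction J0 N \<xi> t \<omega> = dir (J0 \<omega> + (\<Sum>k<N t \<omega>. \<xi> k \<omega>))"

datatype source = Initial | Clock | Turn nat

locale turning_motion = poisson_process M N lambda
  for M :: "'a measure" and N :: "real \<Rightarrow> 'a \<Rightarrow> nat" and lambda :: real +
  fixes J0 :: "'a \<Rightarrow> int" and \<xi> :: "nat \<Rightarrow> 'a \<Rightarrow> int" and p q :: real
  assumes p_nonneg: "0 \<le> p" and q_nonneg: "0 \<le> q" and pq_le_1: "p + q \<le> 1"
    and J0_random_variable: "random_variable (count_space UNIV) J0"
    and J0_distr: "distr M (count_space UNIV) J0 = measure_pmf (pmf_of_set {0, 1, 2, 3})"
    and turn_random_variable: "\<And>n. random_variable (count_space UNIV) (\<xi> n)"
    and turn_left: "\<And>n. prob {\<omega> \<in> space M. \<xi> n \<omega> = 1} = p"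
    and turn_right: "\<And>n. prob {\<omega> \<in> space M. \<xi> n \<omega> = -1} = q"
    and turn_back: "\<And>n. prob {\<omega> \<in> space M. \<xi> n \<omega> = 2} = 1 - p - q"
    and sources_indep:
      "indep_sets
         (\<lambda>i. case i of
            Initial \<Rightarrow> {J0 -` A \<inter> space M | A. True}
          | Clock \<Rightarrow> sigma_sets (space M) {N s -` A \<inter> space M | s A. 0 \<le> s}
          | Turn n \<Rightarrow> {\<xi> n -` A \<inter> space M | A. True})
         UNIV"

definition position :: "real \<Rightarrow> (real \<Rightarrow> 'a \<Rightarrow> real \<times> real) \<Rightarrow> real \<Rightarrow> 'a \<Rightarrow> real \<times> real" where
  "position c D t \<omega> = c *\<^sub>R (LINT \<tau>:{0..t}|lborel. D \<tau> \<omega>)"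

definition vertical_time :: "(real \<Rightarrow> 'a \<Rightarrow> real \<times> real) \<Rightarrow> real \<Rightarrow> 'a \<Rightarrow> real" where
  "vertical_time D t \<omega> = (LINT \<tau>:{0..t}|lborel. indicator {dir 1, dir 3} (D \<tau> \<omega>))"

text \<open>
  \<open>g\<close> is a density on \<open>S\<close> of the (in general defective) law \<open>P(Y \<in> dy, E)\<close>. That law may
  have a singular part outside \<open>S\<close>.
\<close>

definition (in prob_space) joint_density_on ::
  "('a \<Rightarrow> real) \<Rightarrow> ('a \<Rightarrow> bool) \<Rightarrow> real set \<Rightarrow> (real \<Rightarrow> real) \<Rightarrow> bool" where
  "joint_density_on Y E S g \<longleftrightarrow>
     set_integrable lborel S g \<and>
     (\<forall>A\<in>sets borel. A \<subseteq> S \<longrightarrow>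
        {\<omega> \<in> space M. Y \<omega> \<in> A \<and> E \<omega>} \<in> events \<and>
        prob {\<omega> \<in> space M. Y \<omega> \<in> A \<and> E \<omega>} = (LINT y:A|lborel. g y))"

end

(*
  While the motion is vertical it reverses at every Poisson event, so on {T(t) = t} the position is
  c or -c times the alternating integral A(t) of (-1)^N over [0, t]: up to a null set the event says
  that the initial index is 1 or 3 and that each of the N(t) turns made so far is a reflection. With
  mu = 1 - p - q, conditioning on the turns reduces the characteristic function to
  E[mu^N(t) cos(theta A(t))]. Replacing A(t) by its Riemann sums on a grid of mesh h turns this
  expectation, by independence of increments, into a power of a 2x2 matrix that agrees to first order
  in h with the flow of x' = a x - theta w, w' = theta x - a w, where a = lambda mu; the limit is the
  telegraph-type solution. The density follows from Levy's uniqueness theorem applied to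
  {T(t) = t, N(t) >= 1}: removing N(t) = 0 removes exactly the atoms at -ct and ct, and the Fourier
  transform of the Bessel density is obtained by integrating a Cauchy product of power series term by
  term.
*)

theory Submission
  imports Defs
begin

subsection \<open>Power series of cosh, sinh and Bessel type\<close>

text \<open>Two features shape the argument. The sign of a^2 - \<theta>^2 depends on the frequency,
  so transforms are expressed by functions that are even in the square root; they are entire in a^2
  - \<theta>^2, and no branch has to be chosen before the final translation into exponentials. And
  the Poisson process is given by its increments, not by waiting times, so a grid is the natural
  discretisation: it asks only that the next increment be independent of the past.

  The matrix has size two because a new grid cell shifts the phase by (-1)^N \<theta> h. The
  addition theorem for the cosine then produces a sine, which must carry the weight (-\<mu>)^N; with
  this weight the pair of expectations closes up.

  The null set is genuine: a path may jump by two at once, or jump exactly at time t, and thus pass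
  through a horizontal heading without spending time in it. Such a path has T(t) = t although some
  turn was not a reflection.

  The atoms reappear on the analytic side: the transform of the derivative kernel is a binomial sum
  without its lowest term, and these missing terms add up to a cosine at the endpoint.\<close>

text \<open>\<open>cosh \<surd>z\<close> and \<open>sinh \<surd>z / \<surd>z\<close> are entire functions of \<open>z\<close>; on the real line they avoid complex roots.\<close>

definition cosh_root :: "real \<Rightarrow> real" where
  "cosh_root z = (\<Sum>m. inverse (fact (2 * m)) * z ^ m)"

definition sinhc_root :: "real \<Rightarrow> real" where
  "sinhc_root z = (\<Sum>m. inverse (fact (2 * m + 1)) * z ^ m)"

text \<open>I_0 as a power series in z^2 / 4. Thus I_0(k sqrt u) becomes a function of u that is
  smooth also at u = 0, where the square root is not.\<close>

definition bessel_B :: "real \<Rightarrow> real" where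
  "bessel_B x = (\<Sum>k. inverse ((fact k)\<^sup>2) * x ^ k)"

text \<open>For x > 0 this is I_1(2 sqrt x) / sqrt x, the derivative of \<open>bessel_B\<close>. It
  is given by its own series so that its transform can be computed termwise.\<close>

definition bessel_B' :: "real \<Rightarrow> real" where
  "bessel_B' x = (\<Sum>k. inverse (fact k * fact (Suc k)) * x ^ k)"

text \<open>Domination by the exponential series. Absolute convergence on the whole line is what the
  termwise derivatives and the Cauchy products ask for.\<close>

lemma summable_norm_below_exp:
  fixes z :: real
  assumes "\<And>m. 0 \<le> c m" "\<And>m. c m \<le> inverse (fact m)"
  shows "summable (\<lambda>m. norm (c m * z ^ m))"
proof (rule summable_comparison_test')
  show "summable (\<lambda>m. inverse (fact m) * \<bar>z\<bar> ^ m)" by (rule summable_exp)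
  show "norm (norm (c m * z ^ m)) \<le> inverse (fact m) * \<bar>z\<bar> ^ m" for m
    using assms[of m] by (auto simp: abs_mult power_abs intro!: mult_right_mono)
qed

lemma summable_cosh_root: "summable (\<lambda>m. norm (inverse (fact (2 * m)) * z ^ m :: real))"
  by (rule summable_norm_below_exp) (auto intro!: le_imp_inverse_le fact_mono)

lemma summable_sinhc_root: "summable (\<lambda>m. norm (inverse (fact (2 * m + 1)) * z ^ m :: real))"
  by (rule summable_norm_below_exp) (auto intro!: le_imp_inverse_le fact_mono simp del: fact_Suc)

lemma summable_bessel_B: "summable (\<lambda>k. norm (inverse ((fact k)\<^sup>2) * z ^ k :: real))"
  by (rule summable_norm_below_exp)
    (auto intro!: le_imp_inverse_le self_le_power simp: fact_ge_1)

lemma summable_bessel_B': "summable (\<lambda>k. norm (inverse (fact k * fact (Suc k)) * z ^ k :: real))"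
proof (rule summable_norm_below_exp)
  show "inverse (fact m * fact (Suc m)) \<le> (inverse (fact m) :: real)" for m
    using mult_left_mono[OF fact_ge_1[of "Suc m"], of "fact m :: real"]
    by (intro le_imp_inverse_le) (auto simp del: fact_Suc)
qed auto

lemma cosh_root_sums: "(\<lambda>m. inverse (fact (2 * m)) * z ^ m) sums cosh_root z"
  unfolding cosh_root_def using summable_norm_cancel[OF summable_cosh_root] by (rule summable_sums)

lemma sinhc_root_sums: "(\<lambda>m. inverse (fact (2 * m + 1)) * z ^ m) sums sinhc_root z"
  unfolding sinhc_root_def using summable_norm_cancel[OF summable_sinhc_root] by (rule summable_sums)

lemma cosh_root_differentiable: "cosh_root field_differentiable at z"
  unfolding cosh_root_def field_differentiable_def
  by (rule exI, rule termdiffs_strong_converges_everywhere)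
    (rule summable_norm_cancel[OF summable_cosh_root])

lemma sinhc_root_differentiable: "sinhc_root field_differentiable at z"
  unfolding sinhc_root_def field_differentiable_def
  by (rule exI, rule termdiffs_strong_converges_everywhere)
    (rule summable_norm_cancel[OF summable_sinhc_root])

lemma bessel_B_deriv: "(bessel_B has_real_derivative bessel_B' x) (at x)"
proof -
  have d: "diffs (\<lambda>k. inverse ((fact k)\<^sup>2)) = (\<lambda>k. inverse (fact k * fact (Suc k)) :: real)"
  proof
    fix k
    have "real (Suc k) * inverse ((real (Suc k) * fact k)\<^sup>2) = inverse (fact k * (real (Suc k) * fact k))"
      by (simp add: power2_eq_square del: of_nat_Suc)
    then show "diffs (\<lambda>k. inverse ((fact k)\<^sup>2)) k = (inverse (fact k * fact (Suc k)) :: real)"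
      unfolding diffs_def fact_Suc .
  qed
  show ?thesis
    using termdiffs_strong_converges_everywhere[OF summable_norm_cancel[OF summable_bessel_B]]
    unfolding d bessel_B_def bessel_B'_def .
qed

lemma bessel_B'_differentiable: "bessel_B' field_differentiable at z"
  unfolding bessel_B'_def field_differentiable_def
  by (rule exI, rule termdiffs_strong_converges_everywhere)
    (rule summable_norm_cancel[OF summable_bessel_B'])

lemma continuous_on_cosh_root [continuous_intros]:
  "continuous_on S f \<Longrightarrow> continuous_on S (\<lambda>x. cosh_root (f x))"
  by (rule continuous_on_compose2[of UNIV cosh_root])
    (auto intro!: continuous_at_imp_continuous_on field_differentiable_imp_continuous_at
      cosh_root_differentiable)

lemma continuous_on_sinhc_root [continuous_intros]:
  "continuous_on S f \<Longrightarrow> continuous_on S (\<lambda>x. sinhc_root (f x))"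
  by (rule continuous_on_compose2[of UNIV sinhc_root])
    (auto intro!: continuous_at_imp_continuous_on field_differentiable_imp_continuous_at
      sinhc_root_differentiable)

lemma continuous_on_bessel_B [continuous_intros]:
  "continuous_on S f \<Longrightarrow> continuous_on S (\<lambda>x. bessel_B (f x))"
  by (rule continuous_on_compose2[of UNIV bessel_B])
    (auto intro!: continuous_at_imp_continuous_on DERIV_isCont[OF bessel_B_deriv])

lemma continuous_on_bessel_B' [continuous_intros]:
  "continuous_on S f \<Longrightarrow> continuous_on S (\<lambda>x. bessel_B' (f x))"
  by (rule continuous_on_compose2[of UNIV bessel_B'])
    (auto intro!: continuous_at_imp_continuous_on field_differentiable_imp_continuous_at
      bessel_B'_differentiable)

lemma bessel_B_nonneg: "0 \<le> x \<Longrightarrow> 0 \<le> bessel_B x"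
  unfolding bessel_B_def
  by (rule suminf_nonneg[OF summable_norm_cancel[OF summable_bessel_B]]) auto

lemma bessel_B'_nonneg: "0 \<le> x \<Longrightarrow> 0 \<le> bessel_B' x"
  unfolding bessel_B'_def
  by (rule suminf_nonneg[OF summable_norm_cancel[OF summable_bessel_B']]) auto

section \<open>Relation to I_0, cosh and sinh; addition theorems\<close>

lemma bessel_I_0: "bessel_I 0 z = bessel_B (z\<^sup>2 / 4)"
proof -
  have "(z / 2) ^ (2 * k + 0) / (fact k * fact (k + 0)) = inverse ((fact k)\<^sup>2) * (z\<^sup>2 / 4) ^ k" for k
  proof -
    have "(z / 2) ^ (2 * k) = (z\<^sup>2 / 4) ^ k"
      by (simp add: power_mult power_divide)
    then show ?thesis by (simp only: power2_eq_square add_0_right divide_inverse mult.commute)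
  qed
  then show ?thesis
    unfolding bessel_I_def bessel_B_def by (simp only:)
qed

text \<open>The series of cosh has only even powers, hence is a series in r^2. Either root r serves,
  whatever the sign of z.\<close>

lemma cosh_root_square:
  fixes r :: complex
  assumes "r\<^sup>2 = of_real z"
  shows "of_real (cosh_root z) = cosh r"
proof -
  have "(\<lambda>m. if even m then r ^ m /\<^sub>R fact m else 0) sums cosh r" by (rule cosh_converges)
  then have "(\<lambda>m. (\<lambda>m. if even m then r ^ m /\<^sub>R fact m else 0) (2 * m)) sums cosh r"
    by (subst sums_mono_reindex) (auto simp: strict_mono_def elim!: evenE)
  then have "(\<lambda>m. of_real (inverse (fact (2 * m)) * z ^ m) :: complex) sums cosh r"
    by (simp add: power_mult assms scaleR_conv_of_real)
  moreover have "(\<lambda>m. of_real (inverse (fact (2 * m)) * z ^ m) :: complex) sums of_real (cosh_root z)"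
    by (intro sums_of_real cosh_root_sums)
  ultimately show ?thesis by (metis sums_unique2)
qed

text \<open>The factor r stays on the left instead of dividing on the right, so r = 0 is
  covered.\<close>

lemma sinhc_root_square:
  fixes r :: complex
  assumes "r\<^sup>2 = of_real z"
  shows "r * of_real (sinhc_root z) = sinh r"
proof -
  have "(\<lambda>m. if even m then 0 else r ^ m /\<^sub>R fact m) sums sinh r" by (rule sinh_converges)
  then have "(\<lambda>m. (\<lambda>m. if even m then 0 else r ^ m /\<^sub>R fact m) (2 * m + 1)) sums sinh r"
    by (subst sums_mono_reindex) (auto simp: strict_mono_def elim!: oddE)
  moreover have "(if even (2 * m + 1) then 0 else r ^ (2 * m + 1) /\<^sub>R fact (2 * m + 1))
      = r * of_real (inverse (fact (2 * m + 1)) * z ^ m)" for m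
  proof -
    have "r ^ (2 * m + 1) = r * (r\<^sup>2) ^ m"
      by (metis power_add power_mult power_one_right mult.commute)
    then have "r ^ (2 * m + 1) = r * of_real (z ^ m)" by (simp only: assms of_real_power)
    moreover have "odd (2 * m + 1)" by simp
    ultimately show ?thesis
      by (metis (no_types, lifting) scaleR_conv_of_real of_real_mult mult.left_commute)
  qed
  ultimately have "(\<lambda>m. r * of_real (inverse (fact (2 * m + 1)) * z ^ m) :: complex) sums sinh r"
    by (simp only:)
  moreover have "(\<lambda>m. r * of_real (inverse (fact (2 * m + 1)) * z ^ m) :: complex)
      sums (r * of_real (sinhc_root z))"
    by (intro sums_mult sums_of_real sinhc_root_sums)
  ultimately show ?thesis by (metis sums_unique2)
qed

lemma cosh_root_0 [simp]: "cosh_root 0 = 1"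
  and sinhc_root_0 [simp]: "sinhc_root 0 = 1"
  using sums_unique2[OF cosh_root_sums[of 0] powser_sums_zero]
    sums_unique2[OF sinhc_root_sums[of 0] powser_sums_zero] by auto

lemma cosh_root_minus_square: "cosh_root (- x\<^sup>2) = cos x"
proof -
  have "complex_of_real (cosh_root (- x\<^sup>2)) = cosh (\<i> * of_real x)"
    by (rule cosh_root_square) (simp add: power_mult_distrib)
  then show ?thesis by (metis cosh_conv_cos cos_of_real mult.assoc mult.commute of_real_eq_iff
    i_squared mult_minus1_right minus_mult_commute cos_minus complex_i_mult_minus)
qed

text \<open>The addition theorem for cosh at s r and h r with r^2 = z, where r occurs only squared.
  Together with the next lemma it gives the semigroup law of the flow in
  \<open>trotter_limit\<close>.\<close>

lemma cosh_root_add: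
  "cosh_root ((s + h)\<^sup>2 * z) = cosh_root (s\<^sup>2 * z) * cosh_root (h\<^sup>2 * z)
     + z * s * h * sinhc_root (s\<^sup>2 * z) * sinhc_root (h\<^sup>2 * z)"
proof -
  define r where "r = csqrt (of_real z)"
  have r2: "r\<^sup>2 = of_real z" by (simp add: r_def)
  have sq: "(of_real x * r)\<^sup>2 = of_real (x\<^sup>2 * z)" for x by (simp add: power_mult_distrib r2)
  have "complex_of_real (cosh_root ((s + h)\<^sup>2 * z)) = cosh (of_real s * r + of_real h * r)"
    using cosh_root_square[OF sq, of "s + h"] by (simp add: algebra_simps)
  also have "\<dots> = cosh (of_real s * r) * cosh (of_real h * r) + sinh (of_real s * r) * sinh (of_real h * r)"
    by (rule cosh_add)
  also have "\<dots> = of_real (cosh_root (s\<^sup>2 * z) * cosh_root (h\<^sup>2 * z))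
     + r\<^sup>2 * of_real (s * h * sinhc_root (s\<^sup>2 * z) * sinhc_root (h\<^sup>2 * z))"
    unfolding cosh_root_square[OF sq, symmetric] sinhc_root_square[OF sq, symmetric]
    by (simp add: power2_eq_square mult_ac)
  also have "\<dots> = complex_of_real (cosh_root (s\<^sup>2 * z) * cosh_root (h\<^sup>2 * z)
     + z * s * h * sinhc_root (s\<^sup>2 * z) * sinhc_root (h\<^sup>2 * z))"
    by (simp add: r2)
  finally show ?thesis by (simp only: of_real_eq_iff)
qed

text \<open>The addition theorem for sinh has a common factor r, which can be cancelled only for z
  \<noteq> 0; at z = 0 both sides are s + h.\<close>

lemma sinhc_root_add:
  "(s + h) * sinhc_root ((s + h)\<^sup>2 * z) = s * sinhc_root (s\<^sup>2 * z) * cosh_root (h\<^sup>2 * z)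
     + h * cosh_root (s\<^sup>2 * z) * sinhc_root (h\<^sup>2 * z)"
proof (cases "z = 0")
  case False
  define r where "r = csqrt (of_real z)"
  have r2: "r\<^sup>2 = of_real z" by (simp add: r_def)
  have sq: "(of_real x * r)\<^sup>2 = of_real (x\<^sup>2 * z)" for x by (simp add: power_mult_distrib r2)
  have "r * complex_of_real ((s + h) * sinhc_root ((s + h)\<^sup>2 * z)) = sinh (of_real s * r + of_real h * r)"
    using sinhc_root_square[OF sq, of "s + h"] by (simp add: algebra_simps)
  also have "\<dots> = sinh (of_real s * r) * cosh (of_real h * r) + cosh (of_real s * r) * sinh (of_real h * r)"
    by (rule sinh_add)
  also have "\<dots> = r * of_real (s * sinhc_root (s\<^sup>2 * z) * cosh_root (h\<^sup>2 * z)
     + h * cosh_root (s\<^sup>2 * z) * sinhc_root (h\<^sup>2 * z))"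
    unfolding cosh_root_square[OF sq, symmetric] sinhc_root_square[OF sq, symmetric]
    by (simp add: algebra_simps)
  finally have "complex_of_real ((s + h) * sinhc_root ((s + h)\<^sup>2 * z)) =
    of_real (s * sinhc_root (s\<^sup>2 * z) * cosh_root (h\<^sup>2 * z)
     + h * cosh_root (s\<^sup>2 * z) * sinhc_root (h\<^sup>2 * z))"
    using False by (simp add: r_def)
  then show ?thesis by (simp only: of_real_eq_iff)
qed auto

subsection \<open>Fourier transforms of the Bessel kernels\<close>

text \<open>The Beta integral L^(2(n+k)+1) B(n + 1/2, k + 1), with half-integer Gamma values written
  as factorials. Splitting off one factor L^2 - y^2 lowers k and needs the claim for both n and n +
  1, so n varies in the induction.\<close>

lemma integral_even_power_diff_squares:
  fixes L :: real
  assumes "0 \<le> L"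
  shows "(LINT y:{-L..L}|lborel. y ^ (2 * n) * (L\<^sup>2 - y\<^sup>2) ^ k)
    = 2 * 4 ^ k * fact k * fact (n + k) * fact (2 * n) / (fact n * fact (2 * (n + k) + 1))
        * L ^ (2 * (n + k) + 1)"
proof (induction k arbitrary: n)
  case 0
  have "(LINT y:{-L..L}|lborel. y ^ (2 * n)) = (L ^ Suc (2 * n) - (- L) ^ Suc (2 * n)) / Suc (2 * n)"
    using integral_power[of "-L" L "2 * n"] assms
    by (simp add: set_lebesgue_integral_def mult.commute)
  also have "\<dots> = 2 * L ^ (2 * n + 1) / (2 * n + 1)" by simp
  also have "\<dots> = 2 * (fact (2 * n) / fact (2 * n + 1)) * L ^ (2 * n + 1)"
  proof -
    have "fact (2 * n) / fact (2 * n + 1) = (1 / (2 * n + 1) :: real)"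
      by (subst frac_eq_eq) (simp_all add: algebra_simps del: fact_Suc, simp add: algebra_simps)
    then show ?thesis by (simp only:) simp
  qed
  finally show ?case by (simp del: fact_Suc)
next
  case (Suc k)
  have int: "set_integrable lborel {-L..L} (\<lambda>y. y ^ (2 * n) * (L\<^sup>2 - y\<^sup>2) ^ k)" for n
    by (intro borel_integrable_atLeastAtMost' continuous_intros)
  \<comment> \<open>The factorials become opaque positive reals; after the shifts are unfolded, a
    rational identity in n and k remains.\<close>
  define P Q R S :: real where "P = fact (n + k)" and "Q = fact (2 * n)" and "R = fact n"
    and "S = fact (2 * (n + k) + 1)"
  have pos: "P > 0" "Q > 0" "R > 0" "S > 0" by (simp_all add: P_def Q_def R_def S_def)
  have e: "fact (Suc n + k) = (real n + real k + 1) * P" "fact (n + Suc k) = (real n + real k + 1) * P"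
    "fact (2 * Suc n) = (2 * real n + 2) * (2 * real n + 1) * Q" "fact (Suc n) = (real n + 1) * R"
    "fact (2 * (Suc n + k) + 1) = (2 * real n + 2 * real k + 3) * (2 * real n + 2 * real k + 2) * S"
    "fact (2 * (n + Suc k) + 1) = (2 * real n + 2 * real k + 3) * (2 * real n + 2 * real k + 2) * S"
    by (simp_all add: P_def Q_def R_def S_def algebra_simps)
  have "(LINT y:{-L..L}|lborel. y ^ (2 * n) * (L\<^sup>2 - y\<^sup>2) ^ Suc k)
      = (LINT y:{-L..L}|lborel. L\<^sup>2 * (y ^ (2 * n) * (L\<^sup>2 - y\<^sup>2) ^ k) - y ^ (2 * Suc n) * (L\<^sup>2 - y\<^sup>2) ^ k)"
    by (rule arg_cong[where f="\<lambda>f. set_lebesgue_integral lborel {-L..L} f"])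
      (auto simp: algebra_simps power2_eq_square)
  also have "\<dots> = L\<^sup>2 * (LINT y:{-L..L}|lborel. y ^ (2 * n) * (L\<^sup>2 - y\<^sup>2) ^ k)
      - (LINT y:{-L..L}|lborel. y ^ (2 * Suc n) * (L\<^sup>2 - y\<^sup>2) ^ k)"
    by (subst set_integral_diff) (intro set_integrable_mult_right int set_integral_mult_right impI refl | simp only: set_integral_mult_right)+
  also have "\<dots> = L\<^sup>2 * (2 * 4 ^ k * fact k * P * Q / (R * S) * L ^ (2 * (n + k) + 1))
      - 2 * 4 ^ k * fact k * fact (Suc n + k) * fact (2 * Suc n) / (fact (Suc n) * fact (2 * (Suc n + k) + 1))
        * L ^ (2 * (Suc n + k) + 1)"
    unfolding Suc.IH P_def Q_def R_def S_def ..
  also have "\<dots> = 2 * 4 ^ k * fact k * L ^ (2 * (n + k) + 3) * (P * Q / (R * S)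
      - (real n + real k + 1) * P * ((2 * real n + 2) * (2 * real n + 1) * Q)
        / ((real n + 1) * R * ((2 * real n + 2 * real k + 3) * (2 * real n + 2 * real k + 2) * S)))"
    unfolding e by (simp add: algebra_simps power_add power2_eq_square power3_eq_cube)
  also have "P * Q / (R * S)
      - (real n + real k + 1) * P * ((2 * real n + 2) * (2 * real n + 1) * Q)
        / ((real n + 1) * R * ((2 * real n + 2 * real k + 3) * (2 * real n + 2 * real k + 2) * S))
     = P * Q / (R * S) * (1 - (2 * real n + 1) / (2 * real n + 2 * real k + 3))"
  proof -
    have "real n + real k + 1 \<noteq> 0" "real n + 1 \<noteq> 0" "2 * real n + 2 * real k + 3 \<noteq> 0" by linarith+
    moreover have "2 * real n + 2 = 2 * (real n + 1)" "2 * real n + 2 * real k + 2 = 2 * (real n + real k + 1)"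
      by simp_all
    ultimately show ?thesis using pos by (simp only:) (simp add: divide_simps, simp add: algebra_simps)
  qed
  also have "1 - (2 * real n + 1) / (2 * real n + 2 * real k + 3)
     = 4 * (real k + 1) * (real n + real k + 1) / ((2 * real n + 2 * real k + 3) * (2 * real n + 2 * real k + 2))"
  proof -
    have "2 * real n + 2 * real k + 2 \<noteq> 0" "2 * real n + 2 * real k + 3 \<noteq> 0" by linarith+
    then show ?thesis by (simp add: divide_simps) (simp add: algebra_simps)
  qed
  also have "2 * 4 ^ k * fact k * L ^ (2 * (n + k) + 3) * (P * Q / (R * S) *
     (4 * (real k + 1) * (real n + real k + 1) / ((2 * real n + 2 * real k + 3) * (2 * real n + 2 * real k + 2))))
    = 2 * 4 ^ Suc k * fact (Suc k) * fact (n + Suc k) * Q / (R * fact (2 * (n + Suc k) + 1)) * L ^ (2 * (n + k) + 3)"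
    unfolding e by (simp add: mult_ac)
  also have "L ^ (2 * (n + k) + 3) = L ^ (2 * (n + Suc k) + 1)" by (simp add: eval_nat_numeral)
  finally show ?case unfolding P_def Q_def R_def S_def .
qed

text \<open>The cosine is \<open>cosh_root\<close> at -(b y)^2, so the integrand is a product of two
  power series. The Cauchy product groups it by total degree m; each group is a polynomial in y
  whose terms are Beta integrals, and in the two applications each group collapses by the binomial
  theorem.\<close>

lemma power_series_cos_transform:
  fixes \<alpha> :: "nat \<Rightarrow> real"
  assumes summ: "\<And>x. summable (\<lambda>k. norm (\<alpha> k * x ^ k))" and "0 \<le> L"
  shows "(\<lambda>m. \<Sum>k\<le>m. \<alpha> k * w ^ k * (inverse (fact (2 * (m - k))) * (- b\<^sup>2) ^ (m - k))
            * (LINT y:{-L..L}|lborel. y ^ (2 * (m - k)) * (L\<^sup>2 - y\<^sup>2) ^ k))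
     sums (LINT y:{-L..L}|lborel. (\<Sum>k. \<alpha> k * (w * (L\<^sup>2 - y\<^sup>2)) ^ k) * cos (b * y))"
proof -
  define T where "T m k y = \<alpha> k * (w * (L\<^sup>2 - y\<^sup>2)) ^ k * (inverse (fact (2 * (m - k))) * (- (b * y)\<^sup>2) ^ (m - k))"
    for m k y
  define f where "f m y = indicator {-L..L} y *\<^sub>R (\<Sum>k\<le>m. T m k y)" for m y
  \<comment> \<open>A majorant uniform in |y| \<le> L: both L^2 - y^2 and y^2 are replaced by L^2.
    It is again a term of a Cauchy product of absolutely convergent series, so sum and integral may
    be exchanged.\<close>
  define C where "C m = (\<Sum>k\<le>m. norm (\<alpha> k * (\<bar>w\<bar> * L\<^sup>2) ^ k) * norm (inverse (fact (2 * (m - k))) * ((b * L)\<^sup>2) ^ (m - k) :: real))"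
    for m
  have sC: "summable C"
    unfolding C_def using Cauchy_product_sums[of "\<lambda>k. norm (\<alpha> k * (\<bar>w\<bar> * L\<^sup>2) ^ k)"
      "\<lambda>k. norm (inverse (fact (2 * k)) * ((b * L)\<^sup>2) ^ k :: real)"] summ summable_cosh_root
    unfolding real_norm_def abs_idempotent by (blast intro: sums_summable)
  have bound: "norm (f m y) \<le> indicator {-L..L} y * C m" for m y
  proof (cases "y \<in> {-L..L}")
    case True
    have y: "y\<^sup>2 \<le> L\<^sup>2" using True by (auto intro!: abs_le_square_iff[THEN iffD1])
    have "norm (\<Sum>k\<le>m. T m k y) \<le> C m"
      unfolding C_def
    proof (rule sum_norm_le)
      fix k assume "k \<in> {..m}"
      have "\<bar>L\<^sup>2 - y\<^sup>2\<bar> \<le> L\<^sup>2" using y by auto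
      then have w: "\<bar>w * (L\<^sup>2 - y\<^sup>2)\<bar> ^ k \<le> (\<bar>w\<bar> * L\<^sup>2) ^ k"
        by (intro power_mono) (auto simp: abs_mult intro!: mult_left_mono)
      have b: "((b * y)\<^sup>2) ^ (m - k) \<le> ((b * L)\<^sup>2) ^ (m - k)"
        unfolding power_mult_distrib[of b] by (intro power_mono mult_left_mono y) auto
      have "\<bar>\<alpha> k\<bar> * \<bar>w * (L\<^sup>2 - y\<^sup>2)\<bar> ^ k * (inverse (fact (2 * (m - k))) * ((b * y)\<^sup>2) ^ (m - k))
          \<le> \<bar>\<alpha> k\<bar> * (\<bar>w\<bar> * L\<^sup>2) ^ k * (inverse (fact (2 * (m - k))) * ((b * L)\<^sup>2) ^ (m - k))"
        by (rule mult_mono[OF mult_left_mono[OF w] mult_left_mono[OF b]]) simp_all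
      then show "norm (T m k y) \<le> norm (\<alpha> k * (\<bar>w\<bar> * L\<^sup>2) ^ k) * norm (inverse (fact (2 * (m - k))) * ((b * L)\<^sup>2) ^ (m - k) :: real)"
        by (simp add: T_def abs_mult power_abs power_mult_distrib)
    qed
    then show ?thesis using True by (simp add: f_def)
  qed (simp add: f_def)
  have intT: "set_integrable lborel {-L..L} (T m k)" for m k
    unfolding T_def by (intro borel_integrable_atLeastAtMost' continuous_intros)
  have int: "integrable lborel (f m)" for m
    using intT unfolding f_def scaleR_sum_right set_integrable_def by (intro Bochner_Integration.integrable_sum)
  have intC: "integrable lborel (\<lambda>y. indicator {-L..L} y * C m)" for m
    by (intro integrable_mult_left integrable_real_indicator) (auto simp: emeasure_lborel_Icc_eq)
  have lC: "(LINT y|lborel. indicator {-L..L} y * C m) = 2 * L * C m" for m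
    using \<open>0 \<le> L\<close> by simp
  have sums: "(\<lambda>m. integral\<^sup>L lborel (f m)) sums (LINT y|lborel. (\<Sum>m. f m y))"
  proof (rule sums_integral)
    show "AE y in lborel. summable (\<lambda>m. norm (f m y))"
      using bound by (intro AE_I2 summable_comparison_test'[OF summable_mult[OF sC]]) auto
    show "summable (\<lambda>m. LINT y|lborel. norm (f m y))"
    proof (rule summable_comparison_test'[OF summable_mult[OF sC, of "2 * L"]])
      show "norm (LINT y|lborel. norm (f m y)) \<le> 2 * L * C m" for m
        using integral_mono[OF integrable_norm[OF int] intC bound, of m] unfolding lC by simp
    qed
  qed (rule int)
  have 1: "(\<Sum>m. f m y) = indicator {-L..L} y *\<^sub>R ((\<Sum>k. \<alpha> k * (w * (L\<^sup>2 - y\<^sup>2)) ^ k) * cos (b * y))" for y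
  proof -
    have "(\<lambda>m. \<Sum>k\<le>m. T m k y) sums ((\<Sum>k. \<alpha> k * (w * (L\<^sup>2 - y\<^sup>2)) ^ k) * cosh_root (- (b * y)\<^sup>2))"
      unfolding T_def cosh_root_def by (rule Cauchy_product_sums[OF summ summable_cosh_root])
    from sums_unique[OF sums_scaleR_right[OF this]] show ?thesis
      unfolding f_def cosh_root_minus_square by (rule sym)
  qed
  have 2: "integral\<^sup>L lborel (f m) = (\<Sum>k\<le>m. \<alpha> k * w ^ k * (inverse (fact (2 * (m - k))) * (- b\<^sup>2) ^ (m - k))
            * (LINT y:{-L..L}|lborel. y ^ (2 * (m - k)) * (L\<^sup>2 - y\<^sup>2) ^ k))" for m
  proof -
    have "integral\<^sup>L lborel (f m) = (\<Sum>k\<le>m. LINT y:{-L..L}|lborel. T m k y)"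
      using intT unfolding f_def scaleR_sum_right set_integrable_def set_lebesgue_integral_def
      by (intro Bochner_Integration.integral_sum)
    also have "\<dots> = (\<Sum>k\<le>m. LINT y:{-L..L}|lborel. \<alpha> k * w ^ k * (inverse (fact (2 * (m - k))) * (- b\<^sup>2) ^ (m - k))
        * (y ^ (2 * (m - k)) * (L\<^sup>2 - y\<^sup>2) ^ k))"
    proof -
      have "(- (b * y)\<^sup>2) ^ j = (- b\<^sup>2) ^ j * y ^ (2 * j)" for j y
        by (simp add: power_mult power_mult_distrib flip: power_mult_distrib[of "- b\<^sup>2"])
      then show ?thesis by (simp add: T_def power_mult_distrib mult_ac)
    qed
    finally show ?thesis by simp
  qed
  show ?thesis using sums unfolding 1 2 set_lebesgue_integral_def .
qed

text \<open>In degree m the factorials of the Beta integral combine with those of the two series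
  into m choose k, and the group becomes a multiple of (4 w - b^2)^m. The multiple is the
  coefficient of \<open>sinhc_root\<close>.\<close>

lemma bessel_B_cos_transform:
  assumes "0 \<le> L"
  shows "(LINT y:{-L..L}|lborel. bessel_B (w * (L\<^sup>2 - y\<^sup>2)) * cos (b * y))
    = 2 * L * sinhc_root (L\<^sup>2 * (4 * w - b\<^sup>2))"
proof -
  have "(\<Sum>k\<le>m. inverse ((fact k)\<^sup>2) * w ^ k * (inverse (fact (2 * (m - k))) * (- b\<^sup>2) ^ (m - k))
            * (LINT y:{-L..L}|lborel. y ^ (2 * (m - k)) * (L\<^sup>2 - y\<^sup>2) ^ k))
      = 2 * L * (inverse (fact (2 * m + 1)) * (L\<^sup>2 * (4 * w - b\<^sup>2)) ^ m)" for m
  proof -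
    have "inverse ((fact k)\<^sup>2) * w ^ k * (inverse (fact (2 * (m - k))) * (- b\<^sup>2) ^ (m - k))
            * (LINT y:{-L..L}|lborel. y ^ (2 * (m - k)) * (L\<^sup>2 - y\<^sup>2) ^ k)
        = 2 * L * (inverse (fact (2 * m + 1)) * (L\<^sup>2) ^ m) * (of_nat (m choose k) * (4 * w) ^ k * (- b\<^sup>2) ^ (m - k))"
      if "k \<le> m" for k
    proof -
      have "L ^ (2 * m + 1) = L * (L ^ m * L ^ m)" by (simp add: power_mult power2_eq_square mult.commute)
      moreover have "(L\<^sup>2) ^ m = L ^ m * L ^ m" by (simp add: power2_eq_square power_mult_distrib)
      ultimately show ?thesis
        unfolding integral_even_power_diff_squares[OF assms] binomial_fact[OF that]
          le_add_diff_inverse2[OF that] power_mult_distrib[of 4 w] power2_eq_square[of "fact k"]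
        by (simp only:) (simp add: field_simps del: fact_Suc)
    qed
    then have "(\<Sum>k\<le>m. inverse ((fact k)\<^sup>2) * w ^ k * (inverse (fact (2 * (m - k))) * (- b\<^sup>2) ^ (m - k))
            * (LINT y:{-L..L}|lborel. y ^ (2 * (m - k)) * (L\<^sup>2 - y\<^sup>2) ^ k))
      = 2 * L * (inverse (fact (2 * m + 1)) * (L\<^sup>2) ^ m) * (4 * w + - b\<^sup>2) ^ m"
      unfolding binomial_ring sum_distrib_left by (intro sum.cong) auto
    then show ?thesis by (simp add: power_mult_distrib)
  qed
  with power_series_cos_transform[OF summable_bessel_B assms, of w b]
  have "(\<lambda>m. 2 * L * (inverse (fact (2 * m + 1)) * (L\<^sup>2 * (4 * w - b\<^sup>2)) ^ m))
      sums (LINT y:{-L..L}|lborel. bessel_B (w * (L\<^sup>2 - y\<^sup>2)) * cos (b * y))"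
    unfolding bessel_B_def by (simp only:)
  from sums_unique2[OF this sums_mult[OF sinhc_root_sums]] show ?thesis .
qed

text \<open>Formally half the derivative of the previous identity in L, the cosine being the
  boundary term. In the series the coefficients are m + 1 choose k + 1, so the binomial expansion
  lacks its term (-b^2)^(m+1); these terms sum to the cosine. Keeping the factor
  \<open>L * w\<close> avoids a division by zero.\<close>

lemma bessel_B'_cos_transform:
  assumes "0 \<le> L"
  shows "L * w * (LINT y:{-L..L}|lborel. bessel_B' (w * (L\<^sup>2 - y\<^sup>2)) * cos (b * y))
    = cosh_root (L\<^sup>2 * (4 * w - b\<^sup>2)) - cos (b * L)"
proof -
  let ?c = "\<lambda>m z. inverse (fact (2 * m)) * z ^ m :: real"
  have "L * w * (\<Sum>k\<le>m. inverse (fact k * fact (Suc k)) * w ^ k * (inverse (fact (2 * (m - k))) * (- b\<^sup>2) ^ (m - k))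
            * (LINT y:{-L..L}|lborel. y ^ (2 * (m - k)) * (L\<^sup>2 - y\<^sup>2) ^ k))
      = ?c (Suc m) (L\<^sup>2 * (4 * w - b\<^sup>2)) - ?c (Suc m) (- (b * L)\<^sup>2)" for m
  proof -
    have t: "L * w * (inverse (fact k * fact (Suc k)) * w ^ k * (inverse (fact (2 * (m - k))) * (- b\<^sup>2) ^ (m - k))
            * (LINT y:{-L..L}|lborel. y ^ (2 * (m - k)) * (L\<^sup>2 - y\<^sup>2) ^ k))
        = ?c (Suc m) (L\<^sup>2) * (of_nat (Suc m choose Suc k) * (4 * w) ^ Suc k * (- b\<^sup>2) ^ (Suc m - Suc k))"
      if "k \<le> m" for k
    proof -
      have L: "L ^ (2 * m + 1) * L = (L\<^sup>2) ^ Suc m"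
        by (simp add: power_mult power2_eq_square)
      have f: "fact (2 * Suc m) = 2 * real (Suc m) * fact (2 * m + 1)"
        "fact (Suc m) = real (Suc m) * fact m" by (simp_all add: algebra_simps)
      have s: "Suc k \<le> Suc m" using that by simp
      have "L * w * (inverse (fact k * fact (Suc k)) * w ^ k * (inverse (fact (2 * (m - k))) * (- b\<^sup>2) ^ (m - k))
            * (LINT y:{-L..L}|lborel. y ^ (2 * (m - k)) * (L\<^sup>2 - y\<^sup>2) ^ k))
         = (L ^ (2 * m + 1) * L) * w ^ Suc k * 4 ^ k * 2 * fact m / (fact (Suc k) * fact (m - k) * fact (2 * m + 1)) * (- b\<^sup>2) ^ (m - k)"
        unfolding integral_even_power_diff_squares[OF assms] le_add_diff_inverse2[OF that]
        by (simp add: field_simps del: fact_Suc)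
      also have "\<dots> = ?c (Suc m) (L\<^sup>2) * (of_nat (Suc m choose Suc k) * (4 * w) ^ Suc k * (- b\<^sup>2) ^ (Suc m - Suc k))"
        unfolding L binomial_fact[OF s] f power_mult_distrib[of 4 w] diff_Suc_Suc
        by (simp add: field_simps del: fact_Suc of_nat_Suc)
      finally show ?thesis .
    qed
    have "L * w * (\<Sum>k\<le>m. inverse (fact k * fact (Suc k)) * w ^ k * (inverse (fact (2 * (m - k))) * (- b\<^sup>2) ^ (m - k))
            * (LINT y:{-L..L}|lborel. y ^ (2 * (m - k)) * (L\<^sup>2 - y\<^sup>2) ^ k))
      = ?c (Suc m) (L\<^sup>2) * (\<Sum>k\<le>m. of_nat (Suc m choose Suc k) * (4 * w) ^ Suc k * (- b\<^sup>2) ^ (Suc m - Suc k))"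
      unfolding sum_distrib_left by (intro sum.cong refl t) auto
    also have "(\<Sum>k\<le>m. of_nat (Suc m choose Suc k) * (4 * w) ^ Suc k * (- b\<^sup>2) ^ (Suc m - Suc k))
      = (4 * w + - b\<^sup>2) ^ Suc m - (- b\<^sup>2) ^ Suc m"
      unfolding binomial_ring sum.atMost_Suc_shift by simp
    also have "?c (Suc m) (L\<^sup>2) * ((4 * w + - b\<^sup>2) ^ Suc m - (- b\<^sup>2) ^ Suc m)
      = ?c (Suc m) (L\<^sup>2 * (4 * w - b\<^sup>2)) - ?c (Suc m) (L\<^sup>2 * (- b\<^sup>2))"
      unfolding power_mult_distrib by (simp add: algebra_simps)
    finally show ?thesis by (simp add: power_mult_distrib mult.commute)
  qed
  with sums_mult[OF power_series_cos_transform[OF summable_bessel_B' assms, of w b], of "L * w"]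
  have "(\<lambda>m. ?c (Suc m) (L\<^sup>2 * (4 * w - b\<^sup>2)) - ?c (Suc m) (- (b * L)\<^sup>2))
      sums (L * w * (LINT y:{-L..L}|lborel. bessel_B' (w * (L\<^sup>2 - y\<^sup>2)) * cos (b * y)))"
    unfolding bessel_B'_def by (simp only:)
  \<comment> \<open>Both series start at degree one here; the omitted constant terms are equal and
    cancel in the difference.\<close>
  moreover have "(\<lambda>m. ?c (Suc m) (L\<^sup>2 * (4 * w - b\<^sup>2)) - ?c (Suc m) (- (b * L)\<^sup>2))
      sums ((cosh_root (L\<^sup>2 * (4 * w - b\<^sup>2)) - ?c 0 (L\<^sup>2 * (4 * w - b\<^sup>2)))
           - (cosh_root (- (b * L)\<^sup>2) - ?c 0 (- (b * L)\<^sup>2)))"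
    using cosh_root_sums by (intro sums_diff) (subst sums_Suc_iff, simp)+
  ultimately show ?thesis using sums_unique2 by (fastforce simp: cosh_root_minus_square)
qed

subsection \<open>The Lie product limit\<close>

text \<open>The inner function h^2 z has slope zero at 0, so the slope of the outer function does
  not enter. With the next lemma this gives the first-order expansion of the flow.\<close>

lemma cosh_root_has_derivative_at_0:
  "((\<lambda>h. cosh_root (h\<^sup>2 * z)) has_real_derivative 0) (at 0)"
proof -
  obtain D where D: "(cosh_root has_real_derivative D) (at (0\<^sup>2 * z))"
    using cosh_root_differentiable unfolding field_differentiable_def by blast
  have "((\<lambda>h. h\<^sup>2 * z) has_real_derivative 0) (at 0)"
    by (auto intro!: derivative_eq_intros)
  from DERIV_chain2[OF D this] show ?thesis by simp
qed

lemma sinhc_root_has_derivative_at_0: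
  "((\<lambda>h. h * sinhc_root (h\<^sup>2 * z)) has_real_derivative 1) (at 0)"
proof -
  obtain D where D: "(sinhc_root has_real_derivative D) (at (0\<^sup>2 * z))"
    using sinhc_root_differentiable unfolding field_differentiable_def by blast
  have "((\<lambda>h. h\<^sup>2 * z) has_real_derivative 0) (at 0)"
    by (auto intro!: derivative_eq_intros)
  from DERIV_mult[OF DERIV_ident DERIV_chain2[OF D this]] show ?thesis by simp
qed

text \<open>One step is a rotation by \<theta> h followed by the scaling diag(exp(a h), exp(-a h)).
  Consistency (a local error of smaller order than h) and stability (growth at most exp(K h) per
  step) give convergence to the exact flow.\<close>

lemma trotter_limit:
  fixes a \<theta> t :: real and x w :: "nat \<Rightarrow> nat \<Rightarrow> real"
  assumes "0 < t" "0 \<le> a"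
    and init: "\<And>n. x n 0 = 1" "\<And>n. w n 0 = 0"
    and stepx: "\<And>n k. 0 < n \<Longrightarrow> k < n \<Longrightarrow> x n (Suc k) = exp (a * (t / n)) * (cos (\<theta> * (t / n)) * x n k - sin (\<theta> * (t / n)) * w n k)"
    and stepw: "\<And>n k. 0 < n \<Longrightarrow> k < n \<Longrightarrow> w n (Suc k) = exp (- a * (t / n)) * (cos (\<theta> * (t / n)) * w n k + sin (\<theta> * (t / n)) * x n k)"
  shows "(\<lambda>n. x n n) \<longlonglongrightarrow> cosh_root (t\<^sup>2 * (a\<^sup>2 - \<theta>\<^sup>2)) + a * t * sinhc_root (t\<^sup>2 * (a\<^sup>2 - \<theta>\<^sup>2))"
proof -
  \<comment> \<open>The generator [[a, -\<theta>], [\<theta>, -a]] has square \<rho> times the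
    identity, so its exponential at time s is C(s) times the identity plus S(s) times the generator.
    \<open>X\<close> and \<open>W\<close> are the first column, the orbit of (1, 0).\<close>
  define \<rho> where "\<rho> = a\<^sup>2 - \<theta>\<^sup>2"
  define C where "C s = cosh_root (s\<^sup>2 * \<rho>)" for s
  define S where "S s = s * sinhc_root (s\<^sup>2 * \<rho>)" for s
  define X where "X s = C s + a * S s" for s
  define W where "W s = \<theta> * S s" for s
  have X_add: "X (s + h) = (C h + a * S h) * X s - \<theta> * S h * W s" for s h
    unfolding X_def W_def C_def S_def cosh_root_add sinhc_root_add \<rho>_def
    by (simp add: algebra_simps power2_eq_square)
  have W_add: "W (s + h) = (C h - a * S h) * W s + \<theta> * S h * X s" for s h
    unfolding X_def W_def C_def S_def sinhc_root_add
    by (simp add: algebra_simps power2_eq_square)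
  have "continuous_on {0..t} (\<lambda>s. \<bar>X s\<bar> + \<bar>W s\<bar>)"
    unfolding X_def W_def C_def S_def by (intro continuous_intros)
  then have "bdd_above ((\<lambda>s. \<bar>X s\<bar> + \<bar>W s\<bar>) ` {0..t})"
    by (intro bounded_imp_bdd_above compact_imp_bounded compact_continuous_image) auto
  then obtain B where "\<forall>s\<in>{0..t}. \<bar>X s\<bar> + \<bar>W s\<bar> \<le> B"
    by (auto simp: bdd_above_def)
  then have B: "\<And>s. 0 \<le> s \<Longrightarrow> s \<le> t \<Longrightarrow> \<bar>X s\<bar> + \<bar>W s\<bar> \<le> B" by auto
  have B0: "0 \<le> B" using B[of 0] \<open>0 < t\<close> by linarith
  \<comment> \<open>Up to sign, \<open>d1\<close> to \<open>d4\<close> are the entries of the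
    product step minus those of the exact flow over time h. Value and slope vanish at h = 0.\<close>
  define d1 where "d1 h = exp (a * h) * cos (\<theta> * h) - (C h + a * S h)" for h
  define d2 where "d2 h = exp (a * h) * sin (\<theta> * h) - \<theta> * S h" for h
  define d3 where "d3 h = exp (- a * h) * cos (\<theta> * h) - (C h - a * S h)" for h
  define d4 where "d4 h = exp (- a * h) * sin (\<theta> * h) - \<theta> * S h" for h
  define \<epsilon> where "\<epsilon> h = \<bar>d1 h\<bar> + \<bar>d2 h\<bar> + \<bar>d3 h\<bar> + \<bar>d4 h\<bar>" for h
  note der = cosh_root_has_derivative_at_0[of \<rho>, folded C_def] sinhc_root_has_derivative_at_0[of \<rho>, folded S_def]
  have CS0: "C 0 = 1" "S 0 = 0" by (simp_all add: C_def S_def)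
  have "(d1 has_real_derivative 0) (at 0)" "(d2 has_real_derivative 0) (at 0)"
    "(d3 has_real_derivative 0) (at 0)" "(d4 has_real_derivative 0) (at 0)"
    unfolding d1_def d2_def d3_def d4_def by (auto intro!: derivative_eq_intros der)
  then have quot: "((\<lambda>h. d1 h / h) \<longlongrightarrow> 0) (at 0)" "((\<lambda>h. d2 h / h) \<longlongrightarrow> 0) (at 0)"
    "((\<lambda>h. d3 h / h) \<longlongrightarrow> 0) (at 0)" "((\<lambda>h. d4 h / h) \<longlongrightarrow> 0) (at 0)"
    by (simp_all add: DERIV_def d1_def d2_def d3_def d4_def CS0)
  have lim_h: "filterlim (\<lambda>n. t / real n) (at 0) sequentially"
    using \<open>0 < t\<close>
    by (auto simp: filterlim_at intro!: lim_const_over_n eventually_sequentiallyI[of 1])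
  have "((\<lambda>h. \<bar>d1 h / h\<bar> + \<bar>d2 h / h\<bar> + \<bar>d3 h / h\<bar> + \<bar>d4 h / h\<bar>) \<longlongrightarrow> 0) (at 0)"
    by (intro tendsto_add_zero tendsto_rabs_zero quot)
  then have "((\<lambda>h. \<epsilon> h / \<bar>h\<bar>) \<longlongrightarrow> 0) (at 0)"
    by (simp add: \<epsilon>_def abs_divide add_divide_distrib)
  from filterlim_compose[OF this lim_h]
  have \<epsilon>_lim: "(\<lambda>n. \<epsilon> (t / n) / \<bar>t / n\<bar>) \<longlonglongrightarrow> 0" .
  \<comment> \<open>The rate comes from exp(a h) (1 + |\<theta>| h) \<le> exp((a + |\<theta>|) h), a
    bound for the growth of the l1 norm in one step.\<close>
  define K where "K = a + \<bar>\<theta>\<bar>"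
  have K: "0 \<le> K" using \<open>0 \<le> a\<close> by (simp add: K_def)
  have amp: "exp (a * h) * (\<bar>cos (\<theta> * h)\<bar> + \<bar>sin (\<theta> * h)\<bar>) \<le> exp (K * h)"
     "exp (- a * h) * (\<bar>cos (\<theta> * h)\<bar> + \<bar>sin (\<theta> * h)\<bar>) \<le> exp (K * h)" if "0 \<le> h" for h
  proof -
    have "\<bar>cos (\<theta> * h)\<bar> + \<bar>sin (\<theta> * h)\<bar> \<le> 1 + \<bar>\<theta>\<bar> * h"
      using abs_cos_le_one[of "\<theta> * h"] abs_sin_x_le_abs_x[of "\<theta> * h"] that by (auto simp: abs_mult intro!: add_mono)
    also have "\<dots> \<le> exp (\<bar>\<theta>\<bar> * h)" by (simp add: exp_ge_add_one_self)
    finally have 1: "\<bar>cos (\<theta> * h)\<bar> + \<bar>sin (\<theta> * h)\<bar> \<le> exp (\<bar>\<theta>\<bar> * h)" .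
    have e: "exp (a * h) * exp (\<bar>\<theta>\<bar> * h) = exp (K * h)" by (simp add: K_def algebra_simps exp_add)
    show 2: "exp (a * h) * (\<bar>cos (\<theta> * h)\<bar> + \<bar>sin (\<theta> * h)\<bar>) \<le> exp (K * h)"
      unfolding e[symmetric] by (intro mult_left_mono 1) simp
    have "exp (- a * h) \<le> exp (a * h)" using that \<open>0 \<le> a\<close> by simp
    then show "exp (- a * h) * (\<bar>cos (\<theta> * h)\<bar> + \<bar>sin (\<theta> * h)\<bar>) \<le> exp (K * h)"
      using 2 by (meson mult_right_mono order_trans abs_ge_zero add_nonneg_nonneg)
  qed
  \<comment> \<open>A discrete Gronwall estimate in the l1 norm: each of the k steps adds at most
    \<epsilon>(h) B, and each contribution is later amplified by at most exp(K k h).\<close>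
  have err: "\<bar>x n k - X (k * (t / n))\<bar> + \<bar>w n k - W (k * (t / n))\<bar> \<le> k * exp (K * (k * (t / n))) * (\<epsilon> (t / n) * B)"
    if n: "0 < n" and "k \<le> n" for n k
    using \<open>k \<le> n\<close>
  proof (induction k)
    case 0
    show ?case by (simp add: init X_def W_def CS0)
  next
    case (Suc k)
    define h where "h = t / n"
    define s where "s = k * h"
    have h: "0 \<le> h" using \<open>0 < t\<close> by (simp add: h_def)
    have s: "0 \<le> s" "s \<le> t" using h Suc.prems n \<open>0 < t\<close>
      by (auto simp: s_def h_def divide_simps mult_left_mono)
    have sS: "Suc k * h = s + h" by (simp add: s_def algebra_simps)
    define u v where "u = x n k - X s" and "v = w n k - W s"
    let ?c = "cos (\<theta> * h)" and ?s = "sin (\<theta> * h)"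
    have IH: "\<bar>u\<bar> + \<bar>v\<bar> \<le> k * exp (K * s) * (\<epsilon> h * B)"
      using Suc by (simp add: u_def v_def s_def h_def)
    have \<epsilon>0: "0 \<le> \<epsilon> h" by (simp add: \<epsilon>_def)
    have ux: "x n (Suc k) - X (s + h) = exp (a * h) * (?c * u - ?s * v) + (d1 h * X s - d2 h * W s)"
      using stepx[OF n, of k] Suc.prems unfolding X_add d1_def d2_def u_def v_def h_def[symmetric]
      by (simp add: algebra_simps)
    have vw: "w n (Suc k) - W (s + h) = exp (- a * h) * (?c * v + ?s * u) + (d3 h * W s + d4 h * X s)"
      using stepw[OF n, of k] Suc.prems unfolding W_add d3_def d4_def u_def v_def h_def[symmetric]
      by (simp add: algebra_simps)
    have tri: "\<bar>p * q - r * m\<bar> \<le> \<bar>p\<bar> * \<bar>q\<bar> + \<bar>r\<bar> * \<bar>m\<bar>" "\<bar>p * q + r * m\<bar> \<le> \<bar>p\<bar> * \<bar>q\<bar> + \<bar>r\<bar> * \<bar>m\<bar>" for p q r m :: real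
      by (metis abs_mult abs_triangle_ineq4) (metis abs_mult abs_triangle_ineq)
    have "\<bar>x n (Suc k) - X (s + h)\<bar> + \<bar>w n (Suc k) - W (s + h)\<bar>
      \<le> (exp (a * h) * (\<bar>?c\<bar> * \<bar>u\<bar> + \<bar>?s\<bar> * \<bar>v\<bar>) + (\<bar>d1 h\<bar> * \<bar>X s\<bar> + \<bar>d2 h\<bar> * \<bar>W s\<bar>))
       + (exp (- a * h) * (\<bar>?c\<bar> * \<bar>v\<bar> + \<bar>?s\<bar> * \<bar>u\<bar>) + (\<bar>d3 h\<bar> * \<bar>W s\<bar> + \<bar>d4 h\<bar> * \<bar>X s\<bar>))"
      unfolding ux vw
      by (intro add_mono order_trans[OF abs_triangle_ineq] order_trans[OF eq_refl[OF abs_mult]])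
        (auto intro!: tri mult_left_mono)
    also have "\<dots> \<le> (exp (a * h) * (\<bar>?c\<bar> + \<bar>?s\<bar>) * \<bar>u\<bar> + exp (a * h) * (\<bar>?c\<bar> + \<bar>?s\<bar>) * \<bar>v\<bar>) + \<epsilon> h * B"
    proof -
      have "exp (- a * h) \<le> exp (a * h)" using h \<open>0 \<le> a\<close> by simp
      then have "exp (- a * h) * (\<bar>?c\<bar> * \<bar>v\<bar> + \<bar>?s\<bar> * \<bar>u\<bar>) \<le> exp (a * h) * (\<bar>?c\<bar> * \<bar>v\<bar> + \<bar>?s\<bar> * \<bar>u\<bar>)"
        by (rule mult_right_mono) simp
      moreover have "\<bar>d1 h\<bar> * \<bar>X s\<bar> + \<bar>d2 h\<bar> * \<bar>W s\<bar> + (\<bar>d3 h\<bar> * \<bar>W s\<bar> + \<bar>d4 h\<bar> * \<bar>X s\<bar>)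
        \<le> \<epsilon> h * (\<bar>X s\<bar> + \<bar>W s\<bar>)"
        by (simp add: \<epsilon>_def algebra_simps)
      moreover have "\<epsilon> h * (\<bar>X s\<bar> + \<bar>W s\<bar>) \<le> \<epsilon> h * B"
        using B[OF s] \<epsilon>0 by (rule mult_left_mono)
      ultimately show ?thesis by (simp add: algebra_simps)
    qed
    also have "\<dots> \<le> exp (K * h) * (\<bar>u\<bar> + \<bar>v\<bar>) + \<epsilon> h * B"
      using amp(1)[OF h] by (simp add: distrib_left mult_right_mono add_mono)
    also have "\<dots> \<le> exp (K * h) * (k * exp (K * s) * (\<epsilon> h * B)) + exp (K * (s + h)) * (\<epsilon> h * B)"
    proof (intro add_mono mult_left_mono IH)
      have "0 \<le> K * (s + h)" using K s h by simp
      then have "1 \<le> exp (K * (s + h))" by simp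
      then show "\<epsilon> h * B \<le> exp (K * (s + h)) * (\<epsilon> h * B)"
        using \<epsilon>0 B0 mult_right_mono[of 1 "exp (K * (s + h))" "\<epsilon> h * B"] by simp
    qed simp
    also have "\<dots> = Suc k * exp (K * (s + h)) * (\<epsilon> h * B)"
      by (simp add: algebra_simps exp_add)
    finally show ?case unfolding h_def[symmetric] sS .
  qed
  \<comment> \<open>Since n = t / h, the n local errors together are of size t \<epsilon>(h) / h,
    which tends to 0.\<close>
  have lim: "(\<lambda>n. \<epsilon> (t / n) / \<bar>t / n\<bar> * (t * exp (K * t) * B)) \<longlonglongrightarrow> 0"
    using tendsto_mult_right[OF \<epsilon>_lim, of "t * exp (K * t) * B"] by simp
  have "(\<lambda>n. x n n - X t) \<longlonglongrightarrow> 0"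
  proof (rule tendsto_rabs_zero_cancel, rule tendsto_sandwich[OF _ _ tendsto_const lim])
    show "eventually (\<lambda>n. \<bar>x n n - X t\<bar> \<le> \<epsilon> (t / n) / \<bar>t / n\<bar> * (t * exp (K * t) * B)) sequentially"
    proof (rule eventually_sequentiallyI[of 1])
      fix n :: nat assume n: "1 \<le> n"
      have nt: "real n * (t / n) = t" using n by simp
      have "\<bar>x n n - X t\<bar> \<le> n * exp (K * t) * (\<epsilon> (t / n) * B)"
        using err[of n n] n unfolding nt by auto
      also have "\<dots> = \<epsilon> (t / n) / \<bar>t / n\<bar> * (t * exp (K * t) * B)"
        using n \<open>0 < t\<close> by (simp add: field_simps)
      finally show "\<bar>x n n - X t\<bar> \<le> \<epsilon> (t / n) / \<bar>t / n\<bar> * (t * exp (K * t) * B)" .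
    qed
  qed auto
  then have "(\<lambda>n. x n n) \<longlonglongrightarrow> X t" by (rule LIM_zero_cancel)
  then show ?thesis by (simp add: X_def C_def S_def \<rho>_def mult.assoc)
qed

subsection \<open>Riemann sums along step paths and Poisson tails\<close>

text \<open>Measurability comes from monotonicity, which is known only for nonnegative times;
  \<open>max 0\<close> extends the path to a monotone function on the line. The floor recovers the
  integer value from its real image.\<close>

lemma set_integrable_step_path:
  fixes N :: "real \<Rightarrow> nat" and \<phi> :: "nat \<Rightarrow> real"
  assumes mono: "\<And>s u. 0 \<le> s \<Longrightarrow> s \<le> u \<Longrightarrow> N s \<le> N u" and bound: "\<And>k. \<bar>\<phi> k\<bar> \<le> 1"
    and A: "A \<in> sets borel" "A \<subseteq> {0..t}"
  shows "set_integrable lborel A (\<lambda>\<tau>. \<phi> (N \<tau>))"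
proof -
  have "mono (\<lambda>\<tau>. real (N (max 0 \<tau>)))"
    by (intro monoI of_nat_mono mono) auto
  then have "(\<lambda>\<tau>. real (N (max 0 \<tau>))) \<in> borel_measurable borel"
    by (rule borel_measurable_mono)
  then have "(\<lambda>\<tau>. \<phi> (nat \<lfloor>real (N (max 0 \<tau>))\<rfloor>)) \<in> borel_measurable borel"
    by measurable
  then have meas: "(\<lambda>\<tau>. \<phi> (N (max 0 \<tau>))) \<in> borel_measurable borel" by simp
  have "set_integrable lborel {0..t} (\<lambda>\<tau>. \<phi> (N (max 0 \<tau>)))"
    unfolding set_integrable_def
  proof (rule Bochner_Integration.integrable_bound)
    show "integrable lborel (indicat_real {0..t})"
      by (intro integrable_real_indicator) (auto simp: emeasure_lborel_Icc_eq)
  qed (use meas bound in \<open>auto simp: indicator_def\<close>)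
  then have "set_integrable lborel A (\<lambda>\<tau>. \<phi> (N (max 0 \<tau>)))"
    using A by (auto elim: set_integrable_subset)
  also have "?this \<longleftrightarrow> set_integrable lborel A (\<lambda>\<tau>. \<phi> (N \<tau>))"
    using A by (intro set_integrable_cong) (auto simp: max_def)
  finally show ?thesis .
qed

text \<open>A cell on which the count is constant contributes no error. Any other cell contributes
  at most 2 h, and there are at most N(t) of these, since each of them raises the count.\<close>

lemma step_path_riemann_sum:
  fixes N :: "real \<Rightarrow> nat" and \<phi> :: "nat \<Rightarrow> real" and n :: nat
  assumes mono: "\<And>s u. 0 \<le> s \<Longrightarrow> s \<le> u \<Longrightarrow> N s \<le> N u" and bound: "\<And>k. \<bar>\<phi> k\<bar> \<le> 1"
    and "0 \<le> t" "0 < n"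
  shows "\<bar>(LINT \<tau>:{0..t}|lborel. \<phi> (N \<tau>)) - (t / n) * (\<Sum>k<n. \<phi> (N (real k * (t / real n))))\<bar> \<le> 2 * (t / n) * N t"
proof -
  define h where "h = t / n"
  have h: "0 \<le> h" and nh: "n * h = t" using assms by (auto simp: h_def)
  have int: "set_integrable lborel {a..<b} (\<lambda>\<tau>. \<phi> (N \<tau>))" if "0 \<le> a" for a b
    using that by (intro set_integrable_step_path[where t=b] mono bound) auto
  have const: "(LINT \<tau>:{a..<b}|lborel. c) = (b - a) * c" if "a \<le> b" for a b c :: real
    using that by (simp add: set_lebesgue_integral_def)
  have intc: "set_integrable lborel {a..<b} (\<lambda>\<tau>. c)" if "a \<le> b" for a b c :: real
    using that unfolding set_integrable_def
    by (intro integrable_scaleR_left integrable_real_indicator) auto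
  have "\<bar>(LINT \<tau>:{0..<m * h}|lborel. \<phi> (N \<tau>)) - h * (\<Sum>k<m. \<phi> (N (real k * h)))\<bar> \<le> 2 * h * N (m * h)" for m :: nat
  proof (induction m)
    case 0
    then show ?case using h by (simp add: set_lebesgue_integral_def)
  next
    case (Suc m)
    let ?a = "m * h" and ?b = "Suc m * h"
    have ab: "0 \<le> ?a" "?a \<le> ?b" "?b - ?a = h" using h by (auto simp: algebra_simps)
    have split: "(LINT \<tau>:{0..<?b}|lborel. \<phi> (N \<tau>)) = (LINT \<tau>:{0..<?a}|lborel. \<phi> (N \<tau>)) + (LINT \<tau>:{?a..<?b}|lborel. \<phi> (N \<tau>))"
      using ab int by (subst set_integral_Un[symmetric]) (auto simp: ivl_disj_un_two(3))
    \<comment> \<open>Charging the cell by the increase of the count makes the errors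
      telescope.\<close>
    have loc: "\<bar>(LINT \<tau>:{?a..<?b}|lborel. \<phi> (N \<tau>)) - h * \<phi> (N ?a)\<bar> \<le> 2 * h * (real (N ?b) - real (N ?a))"
    proof (cases "N ?a = N ?b")
      case True
      have "(LINT \<tau>:{?a..<?b}|lborel. \<phi> (N \<tau>)) = (LINT \<tau>:{?a..<?b}|lborel. \<phi> (N ?a))"
      proof (rule set_lebesgue_integral_cong)
        show "\<forall>\<tau>. \<tau> \<in> {?a..<?b} \<longrightarrow> \<phi> (N \<tau>) = \<phi> (N ?a)"
        proof (intro allI impI)
          fix \<tau> assume \<tau>: "\<tau> \<in> {?a..<?b}"
          then have "0 \<le> \<tau>" "?a \<le> \<tau>" "\<tau> \<le> ?b" using ab(1) by (simp_all only: atLeastLessThan_iff) linarith+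
          then have "N ?a \<le> N \<tau>" "N \<tau> \<le> N ?b" using ab(1) by (blast intro: mono)+
          with True show "\<phi> (N \<tau>) = \<phi> (N ?a)" by simp
        qed
      qed simp
      with True show ?thesis using const[OF ab(2)] ab by simp
    next
      case False
      have "N ?a \<le> N ?b" by (rule mono[OF ab(1,2)])
      with False have "1 \<le> real (N ?b) - real (N ?a)" by linarith
      then have 1: "2 * h * 1 \<le> 2 * h * (real (N ?b) - real (N ?a))" using h by (intro mult_left_mono) auto
      have p: "- 1 \<le> \<phi> k" "\<phi> k \<le> 1" for k using bound[of k] by auto
      have "(LINT \<tau>:{?a..<?b}|lborel. \<phi> (N \<tau>)) \<le> h" "- h \<le> (LINT \<tau>:{?a..<?b}|lborel. \<phi> (N \<tau>))"
        using set_integral_mono[OF int[OF ab(1)] intc[OF ab(2), of 1]] set_integral_mono[OF intc[OF ab(2), of "-1"] int[OF ab(1)]] p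
        unfolding const[OF ab(2)] ab(3) by auto
      moreover have "h * \<phi> (N ?a) \<le> h * 1" "h * (- 1) \<le> h * \<phi> (N ?a)"
        by (rule mult_left_mono[OF p(2) h], rule mult_left_mono[OF p(1) h])
      ultimately show ?thesis using 1 by linarith
    qed
    have "h * (\<Sum>k<Suc m. \<phi> (N (real k * h))) = h * (\<Sum>k<m. \<phi> (N (real k * h))) + h * \<phi> (N ?a)"
      by (simp add: algebra_simps)
    moreover have "2 * h * (real (N ?b) - real (N ?a)) = 2 * h * real (N ?b) - 2 * h * real (N ?a)"
      by (simp add: algebra_simps)
    ultimately show ?case using Suc loc split by linarith
  qed
  from this[of n] have "\<bar>(LINT \<tau>:{0..<t}|lborel. \<phi> (N \<tau>)) - h * (\<Sum>k<n. \<phi> (N (real k * h)))\<bar> \<le> 2 * h * N t"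
    unfolding nh .
  moreover have "(LINT \<tau>:{0..<t}|lborel. \<phi> (N \<tau>)) = (LINT \<tau>:{0..t}|lborel. \<phi> (N \<tau>))"
    by (rule set_integral_discrete_difference[of "{t}"]) auto
  ultimately show ?thesis by (simp add: h_def)
qed

lemma step_path_riemann_limit:
  fixes N :: "real \<Rightarrow> nat" and \<phi> :: "nat \<Rightarrow> real"
  assumes mono: "\<And>s u. 0 \<le> s \<Longrightarrow> s \<le> u \<Longrightarrow> N s \<le> N u" and bound: "\<And>k. \<bar>\<phi> k\<bar> \<le> 1" and "0 \<le> t"
  shows "(\<lambda>n::nat. (t / n) * (\<Sum>k<n. \<phi> (N (real k * (t / real n))))) \<longlonglongrightarrow> (LINT \<tau>:{0..t}|lborel. \<phi> (N \<tau>))"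
proof -
  have lim: "(\<lambda>n. 2 * t * N t / real n) \<longlonglongrightarrow> 0" by (rule lim_const_over_n)
  have "(\<lambda>n::nat. (t / n) * (\<Sum>k<n. \<phi> (N (real k * (t / real n)))) - (LINT \<tau>:{0..t}|lborel. \<phi> (N \<tau>))) \<longlonglongrightarrow> 0"
  proof (rule tendsto_rabs_zero_cancel, rule tendsto_sandwich[OF _ _ tendsto_const lim])
    show "eventually (\<lambda>n. \<bar>(t / n) * (\<Sum>k<n. \<phi> (N (real k * (t / real n)))) - (LINT \<tau>:{0..t}|lborel. \<phi> (N \<tau>))\<bar>
      \<le> 2 * t * N t / real n) sequentially"
    proof (rule eventually_sequentiallyI[of 1])
      fix n :: nat assume "1 \<le> n"
      then have "\<bar>(LINT \<tau>:{0..t}|lborel. \<phi> (N \<tau>)) - (t / n) * (\<Sum>k<n. \<phi> (N (real k * (t / real n))))\<bar> \<le> 2 * (t / n) * N t"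
        by (intro step_path_riemann_sum[of N \<phi> t n, OF mono bound \<open>0 \<le> t\<close>]) auto
      then show "\<bar>(t / n) * (\<Sum>k<n. \<phi> (N (real k * (t / real n)))) - (LINT \<tau>:{0..t}|lborel. \<phi> (N \<tau>))\<bar>
          \<le> 2 * t * N t / real n"
        by (subst abs_minus_commute) simp
    qed
  qed auto
  then show ?thesis by (rule LIM_zero_cancel)
qed

text \<open>Negative z is included because the weight of the sine changes sign with the count; at z
  = 0 the power \<open>0 ^ n\<close> is the indicator of n = 0.\<close>

lemma poisson_pmf_generating_function:
  fixes z :: real
  assumes "0 < r" "\<bar>z\<bar> \<le> 1"
  shows "(LINT n|measure_pmf (poisson_pmf r). z ^ n) = exp (r * (z - 1))"
proof -
  have "(LINT n|measure_pmf (poisson_pmf r). z ^ n) = (LINT n|count_space UNIV. pmf (poisson_pmf r) n * z ^ n)"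
    unfolding measure_pmf_eq_density by (subst integral_density) auto
  also have "\<dots> = exp (- r) * exp (r * z)"
  proof (rule sums_unique2)
    have "integrable (measure_pmf (poisson_pmf r)) (\<lambda>n. z ^ n)"
      using assms by (intro measure_pmf.integrable_const_bound[of _ 1]) (auto simp: power_abs power_le_one)
    then have "integrable (count_space UNIV) (\<lambda>n. pmf (poisson_pmf r) n * z ^ n)"
      unfolding measure_pmf_eq_density by (subst (asm) integrable_density) auto
    then show "(\<lambda>n. pmf (poisson_pmf r) n * z ^ n) sums (LINT n|count_space UNIV. pmf (poisson_pmf r) n * z ^ n)"
      by (rule sums_integral_count_space_nat)
    have "pmf (poisson_pmf r) n * z ^ n = exp (- r) * ((r * z) ^ n /\<^sub>R fact n)" for n
      using \<open>0 < r\<close> by (simp add: power_mult_distrib field_simps)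
    then show "(\<lambda>n. pmf (poisson_pmf r) n * z ^ n) sums (exp (- r) * exp (r * z))"
      using sums_mult[OF exp_converges] by (simp only:)
  qed
  finally have "(LINT n|measure_pmf (poisson_pmf r). z ^ n) = exp (- r) * exp (r * z)" .
  then show ?thesis by (simp add: exp_add[symmetric] algebra_simps)
qed

lemma poisson_pmf_ge_1: "0 < r \<Longrightarrow> measure (measure_pmf (poisson_pmf r)) {1..} \<le> r"
proof -
  assume r: "0 < r"
  have "measure (measure_pmf (poisson_pmf r)) {1..} = 1 - measure (measure_pmf (poisson_pmf r)) {0}"
    by (subst measure_pmf.prob_compl[symmetric]) (auto intro!: arg_cong2[where f=measure])
  then show ?thesis
    using r exp_ge_add_one_self[of "- r"] by (simp add: measure_pmf_single)
qed

text \<open>The quadratic bound is the point: over n cells with r of order 1 / n, a union bound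
  still tends to 0.\<close>

lemma poisson_pmf_ge_2: "0 < r \<Longrightarrow> measure (measure_pmf (poisson_pmf r)) {2..} \<le> r\<^sup>2"
proof -
  assume r: "0 < r"
  have "measure (measure_pmf (poisson_pmf r)) {2..} = 1 - measure (measure_pmf (poisson_pmf r)) {0, 1}"
    by (subst measure_pmf.prob_compl[symmetric]) (auto intro!: arg_cong2[where f=measure])
  also have "\<dots> = 1 - exp (- r) * (1 + r)"
    using r by (subst measure_measure_pmf_finite) (auto simp: algebra_simps)
  also have "\<dots> \<le> 1 - (1 - r) * (1 + r)"
    using r exp_ge_add_one_self[of "- r"] by (intro diff_left_mono mult_right_mono) auto
  finally show ?thesis by (simp add: algebra_simps power2_eq_square)
qed

subsection \<open>The Poisson process\<close>

context poisson_process
begin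

lemma N_measurable [measurable]: "0 \<le> s \<Longrightarrow> N s \<in> measurable M (count_space UNIV)"
  by (rule N_random_variable)

lemma increment_measurable [measurable]:
  assumes [measurable]: "0 \<le> s" "0 \<le> u"
  shows "(\<lambda>\<omega>. N u \<omega> - N s \<omega>) \<in> measurable M (count_space UNIV)"
  by measurable

lemma expectation_increment_power:
  assumes "0 \<le> s" "s < u" "\<bar>z\<bar> \<le> 1"
  shows "expectation (\<lambda>\<omega>. z ^ (N u \<omega> - N s \<omega>)) = exp (lambda * (u - s) * (z - 1))"
proof -
  have "expectation (\<lambda>\<omega>. z ^ (N u \<omega> - N s \<omega>))
      = (LINT n|distr M (count_space UNIV) (\<lambda>\<omega>. N u \<omega> - N s \<omega>). z ^ n)"
    using assms by (intro integral_distr[symmetric]) auto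
  then show ?thesis
    using assms rate_pos unfolding N_increment_distr[OF assms(1,2)]
    by (simp add: poisson_pmf_generating_function)
qed

lemma prob_increment:
  assumes "0 \<le> s" "s < u"
  shows "prob {\<omega> \<in> space M. N u \<omega> - N s \<omega> \<in> A} = measure (measure_pmf (poisson_pmf (lambda * (u - s)))) A"
proof -
  have "prob {\<omega> \<in> space M. N u \<omega> - N s \<omega> \<in> A}
     = measure (distr M (count_space UNIV) (\<lambda>\<omega>. N u \<omega> - N s \<omega>)) A"
    using assms by (subst measure_distr) (auto intro!: arg_cong2[where f=measure])
  then show ?thesis unfolding N_increment_distr[OF assms] .
qed

lemma N_grid_eq_sum_increments:
  assumes "\<omega> \<in> space M" "0 \<le> h"
  shows "N (real k * h) \<omega> = (\<Sum>i<k. N (real (Suc i) * h) \<omega> - N (real i * h) \<omega>)"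
proof (induction k)
  case 0
  then show ?case using assms N_zero by simp
next
  case (Suc k)
  have "N (real k * h) \<omega> \<le> N (real (Suc k) * h) \<omega>"
    using assms by (intro N_mono mult_right_mono) auto
  then show ?case using Suc by simp
qed

text \<open>The grid values up to index k are partial sums of the first k increments, hence
  independent of the next one. The history lives in a finite product of countable discrete spaces,
  so any function g of it is measurable.\<close>

lemma expectation_grid_times_increment:
  fixes g :: "(nat \<Rightarrow> nat) \<Rightarrow> real"
  assumes "0 < h" "\<bar>z\<bar> \<le> 1" and g: "\<And>v. \<bar>g v\<bar> \<le> 1"
  shows "expectation (\<lambda>\<omega>. g (\<lambda>i\<in>{..k}. N (real i * h) \<omega>) * z ^ (N (real (Suc k) * h) \<omega> - N (real k * h) \<omega>))
    = expectation (\<lambda>\<omega>. g (\<lambda>i\<in>{..k}. N (real i * h) \<omega>)) * exp (lambda * h * (z - 1))"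
proof -
  define D where "D i \<omega> = N (real (Suc i) * h) \<omega> - N (real i * h) \<omega>" for i \<omega>
  define G where "G d = g (\<lambda>i\<in>{..k}. \<Sum>j<i. d j)" for d
  have G: "G (\<lambda>i\<in>{..<k}. D i \<omega>) = g (\<lambda>i\<in>{..k}. N (real i * h) \<omega>)" if "\<omega> \<in> space M" for \<omega>
    unfolding G_def
  proof (intro arg_cong[where f=g] restrict_ext)
    fix i assume "i \<in> {..k}"
    then have "(\<Sum>j<i. (\<lambda>i\<in>{..<k}. D i \<omega>) j) = (\<Sum>j<i. D j \<omega>)"
      by (intro sum.cong) auto
    also have "\<dots> = N (real i * h) \<omega>"
      unfolding D_def using that \<open>0 < h\<close> by (intro N_grid_eq_sum_increments[symmetric]) auto
    finally show "(\<Sum>j<i. (\<lambda>i\<in>{..<k}. D i \<omega>) j) = N (real i * h) \<omega>" .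
  qed
  have Dm: "D i \<in> measurable M (count_space UNIV)" for i
    unfolding D_def using \<open>0 < h\<close> by (intro increment_measurable) auto
  have "indep_vars (\<lambda>_. count_space UNIV) (\<lambda>i \<omega>. N (real (Suc i) * h) \<omega> - N (real i * h) \<omega>) {..<Suc k}"
    using \<open>0 < h\<close> by (intro N_indep_increments[of "\<lambda>i. real i * h"]) auto
  then have "indep_vars (\<lambda>_. count_space UNIV) D {..<Suc k}" by (simp only: D_def[abs_def])
  then have "indep_var (PiM {..<k} (\<lambda>_. count_space UNIV)) (\<lambda>\<omega>. \<lambda>i\<in>{..<k}. D i \<omega>)
      (PiM {k} (\<lambda>_. count_space UNIV)) (\<lambda>\<omega>. \<lambda>i\<in>{k}. D i \<omega>)"
    by (rule indep_var_restrict) auto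
  then have "indep_var borel (G \<circ> (\<lambda>\<omega>. \<lambda>i\<in>{..<k}. D i \<omega>)) borel ((\<lambda>d. z ^ d k) \<circ> (\<lambda>\<omega>. \<lambda>i\<in>{k}. D i \<omega>))"
    by (rule indep_var_compose) (auto simp: count_space_PiM_finite)
  then have ind: "indep_var borel (\<lambda>\<omega>. G (\<lambda>i\<in>{..<k}. D i \<omega>)) borel (\<lambda>\<omega>. z ^ D k \<omega>)"
    by (simp add: comp_def)
  have int: "integrable M (\<lambda>\<omega>. G (\<lambda>i\<in>{..<k}. D i \<omega>))" "integrable M (\<lambda>\<omega>. z ^ D k \<omega>)"
    using ind g \<open>\<bar>z\<bar> \<le> 1\<close> by (auto intro!: integrable_const_bound[of _ 1] simp: G_def indep_var_eq power_abs power_le_one)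
  have "expectation (\<lambda>\<omega>. g (\<lambda>i\<in>{..k}. N (real i * h) \<omega>) * z ^ D k \<omega>)
      = expectation (\<lambda>\<omega>. G (\<lambda>i\<in>{..<k}. D i \<omega>) * z ^ D k \<omega>)"
    by (intro Bochner_Integration.integral_cong) (auto simp: G)
  also have "\<dots> = expectation (\<lambda>\<omega>. G (\<lambda>i\<in>{..<k}. D i \<omega>)) * expectation (\<lambda>\<omega>. z ^ D k \<omega>)"
    by (rule indep_var_lebesgue_integral[OF ind int])
  also have "expectation (\<lambda>\<omega>. G (\<lambda>i\<in>{..<k}. D i \<omega>)) = expectation (\<lambda>\<omega>. g (\<lambda>i\<in>{..k}. N (real i * h) \<omega>))"
    by (intro Bochner_Integration.integral_cong) (auto simp: G)
  also have "expectation (\<lambda>\<omega>. z ^ D k \<omega>) = exp (lambda * h * (z - 1))"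
    unfolding D_def using assms by (subst expectation_increment_power) (auto simp: algebra_simps)
  finally show ?thesis by (simp only: D_def)
qed

section \<open>The alternating integral, its grid sums and the clock\<close>

definition alternating_integral :: "real \<Rightarrow> 'a \<Rightarrow> real" where
  "alternating_integral t \<omega> = (LINT \<tau>:{0..t}|lborel. (- 1) ^ N \<tau> \<omega>)"

definition alternating_sum :: "nat \<Rightarrow> real \<Rightarrow> 'a \<Rightarrow> real" where
  "alternating_sum k h \<omega> = (\<Sum>j<k. (- 1) ^ N (real j * h) \<omega>)"

lemma alternating_sum_limit:
  assumes "\<omega> \<in> space M" "0 \<le> t"
  shows "(\<lambda>n. t / n * alternating_sum n (t / n) \<omega>) \<longlonglongrightarrow> alternating_integral t \<omega>"
  unfolding alternating_sum_def alternating_integral_def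
  using step_path_riemann_limit[of "\<lambda>s. N s \<omega>" "\<lambda>k. (- 1) ^ k" t] assms N_mono by auto

text \<open>Has the \<open>\<sigma>\<close>-algebra attached to \<open>Clock\<close> in \<open>turning_motion\<close>.\<close>

definition clock :: "'a measure" where
  "clock = sigma (space M) {N s -` A \<inter> space M | s A. 0 \<le> s}"

lemma space_clock [simp]: "space clock = space M"
  unfolding clock_def by (rule space_measure_of) auto

lemma sets_clock: "sets clock = sigma_sets (space M) {N s -` A \<inter> space M | s A. 0 \<le> s}"
  unfolding clock_def by (rule sets_measure_of) auto

lemma subalgebra_clock: "subalgebra M clock"
  unfolding subalgebra_def
  by (auto simp: sets_clock intro!: sets.sigma_sets_subset measurable_sets[OF N_measurable])

lemma N_measurable_clock: "0 \<le> s \<Longrightarrow> N s \<in> measurable clock (count_space UNIV)"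
  by (rule measurableI) (auto simp: sets_clock)

lemma alternating_sum_measurable_clock:
  "0 \<le> h \<Longrightarrow> alternating_sum k h \<in> borel_measurable clock"
  unfolding alternating_sum_def
  by (intro borel_measurable_sum measurable_compose[OF N_measurable_clock]) auto

lemma alternating_integral_measurable_clock:
  assumes "0 \<le> t"
  shows "alternating_integral t \<in> borel_measurable clock"
  by (rule borel_measurable_LIMSEQ_real[where u="\<lambda>n \<omega>. t / real n * alternating_sum n (t / real n) \<omega>"])
    (use assms alternating_sum_measurable_clock alternating_sum_limit in auto)

text \<open>Cell k adds (-1)^N \<theta> h to the phase, with N the count at its left end. The sign
  leaves the cosine of this shift unchanged and factors out of its sine; absorbing it into the
  weight turns z^N into (-z)^N. The independent increment over the cell then contributes its
  generating function at z or at -z.\<close>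

lemma alternating_grid_step:
  fixes z \<theta> h :: real
  assumes "0 < h" "0 \<le> z" "z \<le> 1"
  defines "x \<equiv> \<lambda>k. expectation (\<lambda>\<omega>. z ^ N (real k * h) \<omega> * cos (\<theta> * (h * alternating_sum k h \<omega>)))"
    and "w \<equiv> \<lambda>k. expectation (\<lambda>\<omega>. (- z) ^ N (real k * h) \<omega> * sin (\<theta> * (h * alternating_sum k h \<omega>)))"
  shows "x (Suc k) = exp (lambda * h * (z - 1)) * (cos (\<theta> * h) * x k - sin (\<theta> * h) * w k)"
    and "w (Suc k) = exp (lambda * h * (- z - 1)) * (cos (\<theta> * h) * w k + sin (\<theta> * h) * x k)"
proof -
  define S where "S v = \<theta> * (h * (\<Sum>j<k. (- 1) ^ v j))" for v :: "nat \<Rightarrow> nat"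
  define cg where "cg v = z ^ v k * cos (S v)" for v
  define sg where "sg v = (- z) ^ v k * sin (S v)" for v
  define V where "V \<omega> = (\<lambda>i\<in>{..k}. N (real i * h) \<omega>)" for \<omega>
  define D where "D \<omega> = N (real (Suc k) * h) \<omega> - N (real k * h) \<omega>" for \<omega>
  have zb: "\<bar>z\<bar> \<le> 1" "\<bar>- z\<bar> \<le> 1" using assms by auto
  have pow: "\<bar>z ^ m\<bar> \<le> 1" for m using zb by (simp add: power_abs power_le_one)
  have cgb: "\<bar>cg v\<bar> \<le> 1" and sgb: "\<bar>sg v\<bar> \<le> 1" for v
    using pow[of "v k"] by (auto simp: cg_def sg_def abs_mult power_minus[of z] intro!: mult_le_one)
  have VS: "S (V \<omega>) = \<theta> * (h * alternating_sum k h \<omega>)" "V \<omega> k = N (real k * h) \<omega>" for \<omega>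
    by (simp_all add: V_def S_def alternating_sum_def)
  have xk: "x k = expectation (\<lambda>\<omega>. cg (V \<omega>))" and wk: "w k = expectation (\<lambda>\<omega>. sg (V \<omega>))"
    by (simp_all only: x_def w_def cg_def sg_def VS)
  have Vm: "(\<lambda>\<omega>. f (V \<omega>)) \<in> borel_measurable M" for f :: "_ \<Rightarrow> real"
  proof -
    have "V \<in> measurable M (PiM {..k} (\<lambda>_. count_space UNIV))"
      unfolding V_def using \<open>0 < h\<close> by (intro measurable_restrict N_measurable) auto
    then show ?thesis by (rule measurable_compose) (auto simp: count_space_PiM_finite)
  qed
  have Dm: "(\<lambda>\<omega>. y ^ D \<omega>) \<in> borel_measurable M" for y :: real
    unfolding D_def using \<open>0 < h\<close> by (intro measurable_compose[OF increment_measurable]) auto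
  have int: "integrable M (\<lambda>\<omega>. cg (V \<omega>) * y ^ D \<omega>)" "integrable M (\<lambda>\<omega>. sg (V \<omega>) * y ^ D \<omega>)"
    if "\<bar>y\<bar> \<le> 1" for y
  proof -
    have "\<bar>b * y ^ m\<bar> \<le> 1" if "\<bar>b\<bar> \<le> 1" for b m
      using that \<open>\<bar>y\<bar> \<le> 1\<close> by (simp add: abs_mult power_abs power_le_one mult_le_one)
    then have "norm (cg (V \<omega>) * y ^ D \<omega>) \<le> 1" "norm (sg (V \<omega>) * y ^ D \<omega>) \<le> 1" for \<omega>
      unfolding real_norm_def using cgb sgb by blast+
    then show "integrable M (\<lambda>\<omega>. cg (V \<omega>) * y ^ D \<omega>)" "integrable M (\<lambda>\<omega>. sg (V \<omega>) * y ^ D \<omega>)"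
      by (intro integrable_const_bound[of _ 1] AE_I2 borel_measurable_times Vm Dm; simp)+
  qed
  have E: "expectation (\<lambda>\<omega>. cg (V \<omega>) * y ^ D \<omega>) = x k * exp (lambda * h * (y - 1))"
    "expectation (\<lambda>\<omega>. sg (V \<omega>) * y ^ D \<omega>) = w k * exp (lambda * h * (y - 1))" if "\<bar>y\<bar> \<le> 1" for y
    unfolding xk wk V_def D_def
    by (rule expectation_grid_times_increment[OF \<open>0 < h\<close> that cgb],
        rule expectation_grid_times_increment[OF \<open>0 < h\<close> that sgb])
  have Ns: "N (real (Suc k) * h) \<omega> = V \<omega> k + D \<omega>" if "\<omega> \<in> space M" for \<omega>
    using that \<open>0 < h\<close> unfolding VS D_def by (simp add: N_mono mult_right_mono)
  have As: "\<theta> * (h * alternating_sum (Suc k) h \<omega>) = S (V \<omega>) + (- 1) ^ V \<omega> k * (\<theta> * h)" for \<omega>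
    unfolding VS by (simp add: alternating_sum_def algebra_simps)
  have sgn: "cos ((- 1) ^ m * y) = cos y" "sin ((- 1) ^ m * y) = (- 1) ^ m * sin y" for m and y :: real
    by (cases "even m"; simp)+
  have "x (Suc k) = expectation (\<lambda>\<omega>. cos (\<theta> * h) * (cg (V \<omega>) * z ^ D \<omega>) - sin (\<theta> * h) * (sg (V \<omega>) * z ^ D \<omega>))"
    unfolding x_def
  proof (intro Bochner_Integration.integral_cong refl)
    fix \<omega> assume "\<omega> \<in> space M"
    then show "z ^ N (real (Suc k) * h) \<omega> * cos (\<theta> * (h * alternating_sum (Suc k) h \<omega>))
        = cos (\<theta> * h) * (cg (V \<omega>) * z ^ D \<omega>) - sin (\<theta> * h) * (sg (V \<omega>) * z ^ D \<omega>)"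
      unfolding Ns[OF \<open>\<omega> \<in> space M\<close>] As cg_def sg_def cos_add sgn power_add power_minus[of z]
      by (simp only: algebra_simps)
  qed
  also have "\<dots> = cos (\<theta> * h) * expectation (\<lambda>\<omega>. cg (V \<omega>) * z ^ D \<omega>) - sin (\<theta> * h) * expectation (\<lambda>\<omega>. sg (V \<omega>) * z ^ D \<omega>)"
    using int[OF zb(1)] by simp
  also have "\<dots> = exp (lambda * h * (z - 1)) * (cos (\<theta> * h) * x k - sin (\<theta> * h) * w k)"
    unfolding E[OF zb(1)] by (simp only: algebra_simps)
  finally show "x (Suc k) = exp (lambda * h * (z - 1)) * (cos (\<theta> * h) * x k - sin (\<theta> * h) * w k)" .
  have "w (Suc k) = expectation (\<lambda>\<omega>. cos (\<theta> * h) * (sg (V \<omega>) * (- z) ^ D \<omega>) + sin (\<theta> * h) * (cg (V \<omega>) * (- z) ^ D \<omega>))"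
  proof -
    \<comment> \<open>The sign occurs a second time and squares to one, so the cosine comes back
      with weight z^N and the recursion closes.\<close>
    have "(- 1) ^ m * (- 1) ^ m = (1 :: real)" for m by (simp flip: power_mult_distrib)
    then have "(- z) ^ m * ((- 1) ^ m * y) = z ^ m * y" for m y
      unfolding power_minus[of z] by (metis (no_types) mult.assoc mult.commute mult_1)
    then have eq: "(- z) ^ m * (a + (- 1) ^ m * y) = (- z) ^ m * a + z ^ m * y" for m a y
      by (simp only: distrib_left)
    show ?thesis
      unfolding w_def
    proof (intro Bochner_Integration.integral_cong refl)
      fix \<omega> assume "\<omega> \<in> space M"
      have "(- z) ^ (V \<omega> k + D \<omega>) * sin (S (V \<omega>) + (- 1) ^ V \<omega> k * (\<theta> * h))
        = (- z) ^ D \<omega> * ((- z) ^ V \<omega> k * (sin (S (V \<omega>)) * cos (\<theta> * h) + (- 1) ^ V \<omega> k * (cos (S (V \<omega>)) * sin (\<theta> * h))))"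
        unfolding sin_add sgn power_add by (simp only: algebra_simps)
      then show "(- z) ^ N (real (Suc k) * h) \<omega> * sin (\<theta> * (h * alternating_sum (Suc k) h \<omega>))
        = cos (\<theta> * h) * (sg (V \<omega>) * (- z) ^ D \<omega>) + sin (\<theta> * h) * (cg (V \<omega>) * (- z) ^ D \<omega>)"
        unfolding Ns[OF \<open>\<omega> \<in> space M\<close>] As cg_def sg_def eq by (simp only: algebra_simps)
    qed
  qed
  also have "\<dots> = cos (\<theta> * h) * expectation (\<lambda>\<omega>. sg (V \<omega>) * (- z) ^ D \<omega>) + sin (\<theta> * h) * expectation (\<lambda>\<omega>. cg (V \<omega>) * (- z) ^ D \<omega>)"
    using int[OF zb(2)] by simp
  also have "\<dots> = exp (lambda * h * (- z - 1)) * (cos (\<theta> * h) * w k + sin (\<theta> * h) * x k)"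
    unfolding E[OF zb(2)] by (simp only: algebra_simps)
  finally show "w (Suc k) = exp (lambda * h * (- z - 1)) * (cos (\<theta> * h) * w k + sin (\<theta> * h) * x k)" .
qed

text \<open>For z = 1 this is the real part of the characteristic function of the telegraph process
  started in a fixed direction; the weight z^N turns the reversal rate lambda into lambda z while
  the total decay stays exp(-lambda t).\<close>

lemma expectation_telegraph:
  fixes z \<theta> t :: real
  assumes "0 < t" "0 \<le> z" "z \<le> 1"
  shows "expectation (\<lambda>\<omega>. z ^ N t \<omega> * cos (\<theta> * alternating_integral t \<omega>))
    = exp (- lambda * t) * (cosh_root (t\<^sup>2 * ((lambda * z)\<^sup>2 - \<theta>\<^sup>2))
        + lambda * z * t * sinhc_root (t\<^sup>2 * ((lambda * z)\<^sup>2 - \<theta>\<^sup>2)))"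
proof -
  define c where "c n k \<omega> = z ^ N (real k * (t / real n)) \<omega> * cos (\<theta> * (t / real n * alternating_sum k (t / real n) \<omega>))"
    for n k :: nat and \<omega>
  define s where "s n k \<omega> = (- z) ^ N (real k * (t / real n)) \<omega> * sin (\<theta> * (t / real n * alternating_sum k (t / real n) \<omega>))"
    for n k :: nat and \<omega>
  \<comment> \<open>The exponential prefactor removes the common decay exp(-lambda h) of each step,
    leaving the factors exp(lambda z h) and exp(-lambda z h) of the product formula.\<close>
  define x where "x n k = exp (lambda * (real k * (t / real n))) * expectation (c n k)" for n k :: nat
  define w where "w n k = exp (lambda * (real k * (t / real n))) * expectation (s n k)" for n k :: nat
  have "(\<lambda>n. x n n) \<longlonglongrightarrow> cosh_root (t\<^sup>2 * ((lambda * z)\<^sup>2 - \<theta>\<^sup>2))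
      + lambda * z * t * sinhc_root (t\<^sup>2 * ((lambda * z)\<^sup>2 - \<theta>\<^sup>2))"
  proof (rule trotter_limit[where x=x and w=w])
    show "0 < t" "0 \<le> lambda * z" using assms rate_pos by auto
    have "expectation (c n 0) = expectation (\<lambda>_. 1)" "expectation (s n 0) = expectation (\<lambda>_. 0)" for n
      by (intro Bochner_Integration.integral_cong refl; simp add: c_def s_def alternating_sum_def N_zero)+
    then show "x n 0 = 1" "w n 0 = 0" for n
      by (simp_all add: x_def w_def prob_space)
    fix n k :: nat assume n: "0 < n"
    define h where "h = t / real n"
    have h: "0 < h" using n \<open>0 < t\<close> by (simp add: h_def)
    have e: "exp (lambda * (real (Suc k) * h)) * exp (lambda * h * (z - 1)) = exp (lambda * z * h) * exp (lambda * (real k * h))"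
      "exp (lambda * (real (Suc k) * h)) * exp (lambda * h * (- z - 1)) = exp (- (lambda * z) * h) * exp (lambda * (real k * h))"
      by (simp_all add: exp_add[symmetric] algebra_simps)
    note step = alternating_grid_step[OF h \<open>0 \<le> z\<close> \<open>z \<le> 1\<close>, of k \<theta>]
    have xs: "expectation (c n (Suc k)) = exp (lambda * h * (z - 1)) * (cos (\<theta> * h) * expectation (c n k) - sin (\<theta> * h) * expectation (s n k))"
      and ws: "expectation (s n (Suc k)) = exp (lambda * h * (- z - 1)) * (cos (\<theta> * h) * expectation (s n k) + sin (\<theta> * h) * expectation (c n k))"
      unfolding c_def[abs_def] s_def[abs_def] h_def[symmetric] by (rule step)+
    show "x n (Suc k) = exp (lambda * z * (t / n)) * (cos (\<theta> * (t / n)) * x n k - sin (\<theta> * (t / n)) * w n k)"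
      unfolding x_def w_def h_def[symmetric] xs mult.assoc[of "exp _" "exp _", symmetric] e(1)
      by (simp only: algebra_simps)
    show "w n (Suc k) = exp (- (lambda * z) * (t / n)) * (cos (\<theta> * (t / n)) * w n k + sin (\<theta> * (t / n)) * x n k)"
      unfolding x_def w_def h_def[symmetric] ws mult.assoc[of "exp _" "exp _", symmetric] e(2)
      by (simp only: algebra_simps)
  qed
  then have "(\<lambda>n. exp (- lambda * t) * x n n) \<longlonglongrightarrow> exp (- lambda * t) * (cosh_root (t\<^sup>2 * ((lambda * z)\<^sup>2 - \<theta>\<^sup>2))
        + lambda * z * t * sinhc_root (t\<^sup>2 * ((lambda * z)\<^sup>2 - \<theta>\<^sup>2)))"
    by (rule tendsto_mult_left)
  \<comment> \<open>For n \<ge> 1 the last grid point is t itself; for n = 0 the mesh t / n is the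
    default value 0.\<close>
  moreover have "eventually (\<lambda>n. exp (- lambda * t) * x n n
      = expectation (\<lambda>\<omega>. z ^ N t \<omega> * cos (\<theta> * (t / real n * alternating_sum n (t / real n) \<omega>)))) sequentially"
    by (rule eventually_sequentiallyI[of 1]) (auto simp: x_def c_def[abs_def] mult_exp_exp mult.assoc[symmetric])
  ultimately have lim: "(\<lambda>n. expectation (\<lambda>\<omega>. z ^ N t \<omega> * cos (\<theta> * (t / real n * alternating_sum n (t / real n) \<omega>))))
      \<longlonglongrightarrow> exp (- lambda * t) * (cosh_root (t\<^sup>2 * ((lambda * z)\<^sup>2 - \<theta>\<^sup>2))
        + lambda * z * t * sinhc_root (t\<^sup>2 * ((lambda * z)\<^sup>2 - \<theta>\<^sup>2)))"
    by (rule Lim_transform_eventually)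
  have zm [measurable]: "(\<lambda>\<omega>. z ^ N t \<omega>) \<in> borel_measurable M"
    using \<open>0 < t\<close> by (intro measurable_compose[OF N_measurable]) auto
  have am: "alternating_sum n (t / real n) \<in> borel_measurable M" for n
    using \<open>0 < t\<close>
    by (intro measurable_from_subalg[OF subalgebra_clock] alternating_sum_measurable_clock) auto
  have Am: "alternating_integral t \<in> borel_measurable M"
    using \<open>0 < t\<close>
    by (intro measurable_from_subalg[OF subalgebra_clock] alternating_integral_measurable_clock) auto
  have "(\<lambda>n. expectation (\<lambda>\<omega>. z ^ N t \<omega> * cos (\<theta> * (t / real n * alternating_sum n (t / real n) \<omega>))))
      \<longlonglongrightarrow> expectation (\<lambda>\<omega>. z ^ N t \<omega> * cos (\<theta> * alternating_integral t \<omega>))"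
  proof (rule integral_dominated_convergence[where w="\<lambda>_. 1"])
    show "AE \<omega> in M. (\<lambda>n. z ^ N t \<omega> * cos (\<theta> * (t / real n * alternating_sum n (t / real n) \<omega>)))
        \<longlonglongrightarrow> z ^ N t \<omega> * cos (\<theta> * alternating_integral t \<omega>)"
      using alternating_sum_limit \<open>0 < t\<close> by (intro AE_I2 tendsto_intros) auto
    show "AE \<omega> in M. norm (z ^ N t \<omega> * cos (\<theta> * (t / real n * alternating_sum n (t / real n) \<omega>))) \<le> 1" for n
      using assms by (intro AE_I2) (auto simp: abs_mult power_abs power_le_one intro!: mult_le_one)
  qed (use am Am in \<open>auto intro!: borel_measurable_times borel_measurable_cos[THEN measurable_compose_rev] zm\<close>)
  with lim show ?thesis using LIMSEQ_unique by blast
qed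

section \<open>Almost every path visits every value of its count\<close>

text \<open>The path properties permit jumps larger than one and a jump exactly at t. Excluding both
  ensures that every intermediate heading is adopted at some time before t, where it can be detected
  by the time spent in it.\<close>

lemma AE_attains_all_values:
  assumes "0 < t"
  shows "AE \<omega> in M. \<forall>m\<le>N t \<omega>. \<exists>\<tau>. 0 \<le> \<tau> \<and> \<tau> < t \<and> N \<tau> \<omega> = m"
proof -
  define h where "h n = t / real (Suc n)" for n
  have h: "0 < h n" "real (Suc n) * h n = t" for n using assms by (auto simp: h_def)
  define F where "F n k A = {\<omega> \<in> space M. N (real (Suc k) * h n) \<omega> - N (real k * h n) \<omega> \<in> A}" for n k A
  have F: "F n k A \<in> events" for n k A
    using measurable_sets[OF increment_measurable, of "real k * h n" "real (Suc k) * h n" A] h(1)[of n]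
    by (simp add: F_def vimage_def Int_def conj_commute)
  have pF: "prob (F n k A) = measure (measure_pmf (poisson_pmf (lambda * h n))) A" for n k A
    using h(1)[of n] unfolding F_def by (subst prob_increment) (auto simp: algebra_simps)
  have lh: "0 < lambda * h n" for n using rate_pos h(1) by simp
  \<comment> \<open>On a mesh of n + 1 cells: some cell has at least two events, or the last cell
    has at least one. The second clause ensures that N(t) is already reached at a grid point
    strictly before t.\<close>
  define bad where "bad n = (\<Union>k\<le>n. F n k {2..}) \<union> F n n {1..}" for n
  have bad: "bad n \<in> events" for n unfolding bad_def using F by auto
  have pbad: "prob (bad n) \<le> ((lambda * t)\<^sup>2 + lambda * t) * inverse (real (Suc n))" for n
  proof -
    have "prob (bad n) \<le> prob (\<Union>k\<le>n. F n k {2..}) + prob (F n n {1..})"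
      unfolding bad_def using F by (intro measure_Un_le) auto
    also have "\<dots> \<le> (\<Sum>k\<le>n. prob (F n k {2..})) + prob (F n n {1..})"
      using F by (intro add_right_mono measure_UNION_le) auto
    also have "\<dots> \<le> (\<Sum>k\<le>n. (lambda * h n)\<^sup>2) + lambda * h n"
      unfolding pF by (intro add_mono sum_mono poisson_pmf_ge_2 poisson_pmf_ge_1 lh)
    also have "\<dots> = real (Suc n) * (lambda * h n)\<^sup>2 + lambda * h n" by simp
    also have "\<dots> = ((lambda * t)\<^sup>2 + lambda * t) * inverse (real (Suc n))"
      by (simp add: h_def field_simps power2_eq_square del: of_nat_Suc)
    finally show ?thesis .
  qed
  have good: "\<exists>\<tau>. 0 \<le> \<tau> \<and> \<tau> < t \<and> N \<tau> \<omega> = m"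
    if "\<omega> \<in> space M" "\<omega> \<notin> bad n" "m \<le> N t \<omega>" for \<omega> n m
  proof -
    define f where "f k = N (real k * h n) \<omega>" for k
    have f0: "f 0 = 0" using that by (simp add: f_def N_zero)
    have fS: "f (Suc k) \<le> Suc (f k)" if "k \<le> n" for k
      using \<open>\<omega> \<in> space M\<close> \<open>\<omega> \<notin> bad n\<close> that unfolding bad_def F_def f_def by force
    have fn: "N t \<omega> \<le> f n"
      using that h(2)[of n] unfolding bad_def F_def f_def by force
    \<comment> \<open>The first grid point where the count is at least m. Grid values start at 0 and
      rise by at most one per cell, so the count equals m there.\<close>
    define k where "k = (LEAST k. m \<le> f k)"
    have ex: "m \<le> f n" using that(3) fn by simp
    have mk: "m \<le> f k" unfolding k_def by (rule LeastI[of "\<lambda>k. m \<le> f k", OF ex])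
    have kn: "k \<le> n" unfolding k_def by (rule Least_le[of "\<lambda>k. m \<le> f k", OF ex])
    have less: "f j < m" if "j < k" for j
      using not_less_Least[of j "\<lambda>k. m \<le> f k"] that unfolding k_def by simp
    have "f k = m"
    proof (cases k)
      case 0
      then show ?thesis using mk f0 by simp
    next
      case (Suc j)
      then show ?thesis using mk less[of j] fS[of j] kn by simp
    qed
    moreover have "real k * h n < real (Suc n) * h n"
      using kn h(1)[of n] by (intro mult_strict_right_mono) auto
    ultimately show ?thesis using h[of n] unfolding f_def
      by (intro exI[of _ "real k * h n"]) auto
  qed
  \<comment> \<open>The intersection lies in every bad set, so bounds tending to 0 suffice and no
    summability is involved.\<close>
  have null: "prob (\<Inter>n. bad n) = 0"
  proof -
    have "prob (\<Inter>n. bad n) \<le> ((lambda * t)\<^sup>2 + lambda * t) * inverse (real (Suc n))" for n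
      using finite_measure_mono[of "\<Inter>n. bad n" "bad n"] bad pbad[of n] by fastforce
    moreover have "(\<lambda>n. ((lambda * t)\<^sup>2 + lambda * t) * inverse (real (Suc n))) \<longlonglongrightarrow> ((lambda * t)\<^sup>2 + lambda * t) * 0"
      by (intro tendsto_mult tendsto_const LIMSEQ_inverse_real_of_nat)
    ultimately have "prob (\<Inter>n. bad n) \<le> 0"
      using LIMSEQ_le_const by (metis (no_types, lifting) mult_zero_right)
    then show ?thesis by (simp add: measure_le_0_iff)
  qed
  show ?thesis
  proof (rule AE_I)
    show "{\<omega> \<in> space M. \<not> (\<forall>m\<le>N t \<omega>. \<exists>\<tau>. 0 \<le> \<tau> \<and> \<tau> < t \<and> N \<tau> \<omega> = m)} \<subseteq> (\<Inter>n. bad n)"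
      using good by blast
    show "emeasure M (\<Inter>n. bad n) = 0" using null by (simp add: emeasure_eq_measure)
    show "(\<Inter>n. bad n) \<in> events" using bad by auto
  qed
qed

end

subsection \<open>The turning motion\<close>

lemma dir_vertical_iff: "dir j \<in> {dir 1, dir 3} \<longleftrightarrow> odd j"
proof
  have "cos (pi * 3 / 2) = 0" using cos_pi_half cos_add[of pi "pi / 2"] by (simp add: field_simps)
  moreover assume "dir j \<in> {dir 1, dir 3}"
  ultimately have "cos (pi * of_int j / 2) = 0" by (auto simp: dir_def)
  then obtain i :: int where "odd i" "pi * of_int j / 2 = of_int i * (pi / 2)"
    by (auto simp: cos_zero_iff_int)
  then show "odd j" by simp
next
  assume "odd j"
  then have c: "cos (pi * of_int j / 2) = 0" by (auto simp: cos_zero_iff_int)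
  then have "sin (pi * of_int j / 2) = 1 \<or> sin (pi * of_int j / 2) = - 1"
    using sin_cos_squared_add[of "pi * of_int j / 2"] by (simp add: power2_eq_1_iff)
  moreover have "cos (pi * 3 / 2) = 0" "sin (pi * 3 / 2) = - 1"
    using cos_add[of pi "pi / 2"] sin_add[of pi "pi / 2"] by (simp_all add: field_simps)
  ultimately show "dir j \<in> {dir 1, dir 3}" using c by (auto simp: dir_def)
qed

lemma sin_half_turns: "sin (pi * of_int (j + 2 * int m) / 2) = sin (pi * of_int j / 2) * (- 1) ^ m"
proof -
  have "pi * of_int (j + 2 * int m) / 2 = pi * of_int j / 2 + pi * real m" by (simp add: field_simps)
  then show ?thesis by (simp only: sin_add cos_npi2 sin_npi2)
qed

context turning_motion
begin

text \<open>Indexed by the number of events rather than by time: for a fixed outcome this is a plain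
  sequence, so a path integral has the form of the integral of \<phi>(N(\<tau>)) treated
  above.\<close>

definition heading :: "nat \<Rightarrow> 'a \<Rightarrow> int" where
  "heading n \<omega> = J0 \<omega> + (\<Sum>k<n. \<xi> k \<omega>)"

lemma heading_measurable: "heading n \<in> measurable M (count_space UNIV)"
proof (induction n)
  case 0
  then show ?case using J0_random_variable by (simp add: heading_def[abs_def])
next
  case (Suc n)
  have [measurable]: "heading n \<in> measurable M (count_space UNIV)" by fact
  have [measurable]: "\<xi> n \<in> measurable M (count_space UNIV)" by (rule turn_random_variable)
  have "heading (Suc n) = (\<lambda>\<omega>. heading n \<omega> + \<xi> n \<omega>)" by (auto simp: heading_def)
  then show ?case by simp
qed

lemma heading_integral_measurable:
  fixes f :: "int \<Rightarrow> real"
  assumes "\<And>j. \<bar>f j\<bar> \<le> 1" "0 \<le> t"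
  shows "(\<lambda>\<omega>. LINT \<tau>:{0..t}|lborel. f (heading (N \<tau> \<omega>) \<omega>)) \<in> borel_measurable M"
proof (rule borel_measurable_LIMSEQ_real)
  show "(\<lambda>n. t / real n * (\<Sum>k<n. f (heading (N (real k * (t / real n)) \<omega>) \<omega>)))
      \<longlonglongrightarrow> (LINT \<tau>:{0..t}|lborel. f (heading (N \<tau> \<omega>) \<omega>))" if "\<omega> \<in> space M" for \<omega>
    using step_path_riemann_limit[of "\<lambda>s. N s \<omega>" "\<lambda>k. f (heading k \<omega>)" t] assms N_mono that by auto
  have "(\<lambda>\<omega>. f (heading (N s \<omega>) \<omega>)) \<in> borel_measurable M" if "0 \<le> s" for s
    by (rule measurable_compose_countable[OF _ N_measurable[OF that]])
      (rule measurable_compose[OF heading_measurable], simp)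
  then show "(\<lambda>\<omega>. t / real n * (\<Sum>k<n. f (heading (N (real k * (t / real n)) \<omega>) \<omega>))) \<in> borel_measurable M" for n
    using \<open>0 \<le> t\<close> by (intro borel_measurable_times borel_measurable_const borel_measurable_sum) auto
qed

lemma heading_integrable:
  fixes f :: "int \<Rightarrow> real"
  assumes "\<omega> \<in> space M" "\<And>j. \<bar>f j\<bar> \<le> 1"
  shows "set_integrable lborel {0..t} (\<lambda>\<tau>. f (heading (N \<tau> \<omega>) \<omega>))"
  using set_integrable_step_path[of "\<lambda>s. N s \<omega>" "\<lambda>k. f (heading k \<omega>)" "{0..t}" t] assms N_mono by auto

lemma direction_eq: "direction J0 N \<xi> \<tau> \<omega> = dir (heading (N \<tau> \<omega>) \<omega>)"
  by (simp add: direction_def heading_def)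

text \<open>A projection may be moved inside an integral of an integrable function; integrability of
  the planar path is assembled from its two bounded components.\<close>

lemma snd_position:
  assumes "\<omega> \<in> space M"
  shows "snd (position c (direction J0 N \<xi>) t \<omega>)
    = c * (LINT \<tau>:{0..t}|lborel. sin (pi * of_int (heading (N \<tau> \<omega>) \<omega>) / 2))"
proof -
  let ?x = "\<lambda>\<tau>. cos (pi * of_int (heading (N \<tau> \<omega>) \<omega>) / 2)"
  let ?y = "\<lambda>\<tau>. sin (pi * of_int (heading (N \<tau> \<omega>) \<omega>) / 2)"
  have int: "set_integrable lborel {0..t} ?x" "set_integrable lborel {0..t} ?y"
    using heading_integrable[OF assms, of "\<lambda>j. cos (pi * of_int j / 2)"]
      heading_integrable[OF assms, of "\<lambda>j. sin (pi * of_int j / 2)"] by auto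
  have eq: "indicator {0..t} \<tau> *\<^sub>R dir (heading (N \<tau> \<omega>) \<omega>)
      = (indicator {0..t} \<tau> *\<^sub>R ?x \<tau>) *\<^sub>R (1, 0) + (indicator {0..t} \<tau> *\<^sub>R ?y \<tau>) *\<^sub>R (0, 1)" for \<tau>
    by (simp add: dir_def)
  have "integrable lborel (\<lambda>\<tau>. indicator {0..t} \<tau> *\<^sub>R dir (heading (N \<tau> \<omega>) \<omega>))"
    unfolding eq using int unfolding set_integrable_def
    by (intro Bochner_Integration.integrable_add integrable_scaleR_left)
  from integral_bounded_linear[OF bounded_linear_snd this]
  show ?thesis
    by (simp add: position_def direction_eq set_lebesgue_integral_def dir_def)
qed

lemma vertical_time_eq:
  "vertical_time (direction J0 N \<xi>) t \<omega> = (LINT \<tau>:{0..t}|lborel. of_bool (odd (heading (N \<tau> \<omega>) \<omega>)))"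
  unfolding vertical_time_def direction_eq indicator_def dir_vertical_iff ..

lemma vertical_time_measurable:
  "0 \<le> t \<Longrightarrow> vertical_time (direction J0 N \<xi>) t \<in> borel_measurable M"
  using heading_integral_measurable[of "\<lambda>j. of_bool (odd j)" t] unfolding vertical_time_eq[abs_def] by simp

lemma snd_position_measurable:
  assumes "0 \<le> t"
  shows "(\<lambda>\<omega>. snd (position c (direction J0 N \<xi>) t \<omega>)) \<in> borel_measurable M"
proof -
  have "(\<lambda>\<omega>. c * (LINT \<tau>:{0..t}|lborel. sin (pi * of_int (heading (N \<tau> \<omega>) \<omega>) / 2))) \<in> borel_measurable M"
    using heading_integral_measurable[of "\<lambda>j. sin (pi * of_int j / 2)", OF _ assms]
    by (intro borel_measurable_times) auto
  then show ?thesis by (subst measurable_cong[OF snd_position])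
qed

text \<open>By right continuity a horizontal heading at time s persists for a positive time, which
  is then missing from the vertical time. Hence the conclusion holds at every s < t, not merely at
  almost every one.\<close>

lemma vertical_until:
  assumes \<omega>: "\<omega> \<in> space M" and T: "vertical_time (direction J0 N \<xi>) t \<omega> = t" and s: "0 \<le> s" "s < t"
  shows "odd (heading (N s \<omega>) \<omega>)"
proof (rule ccontr)
  assume even: "\<not> odd (heading (N s \<omega>) \<omega>)"
  obtain b where b: "s < b" "\<And>y. s < y \<Longrightarrow> y < b \<Longrightarrow> N y \<omega> = N s \<omega>"
    using N_right_continuous[OF \<omega> s(1)] unfolding eventually_at_right_field by auto
  \<comment> \<open>Cut at t, so that the lost interval lies inside the domain of
    integration.\<close>
  define e where "e = min b t"
  have e: "s < e" "e \<le> t" using b(1) s by (auto simp: e_def)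
  have "t = (LINT \<tau>:{0..t}|lborel. of_bool (odd (heading (N \<tau> \<omega>) \<omega>)))"
    using T by (simp add: vertical_time_eq)
  also have "\<dots> \<le> (LINT \<tau>:{0..t}|lborel. 1 - indicator {s<..<e} \<tau>)"
  proof (rule set_integral_mono)
    show "set_integrable lborel {0..t} (\<lambda>\<tau>. of_bool (odd (heading (N \<tau> \<omega>) \<omega>)) :: real)"
      using heading_integrable[OF \<omega>, of "\<lambda>j. of_bool (odd j)"] by auto
    have "{0..t} \<inter> {s<..<e} = {s<..<e}" using e s by auto
    then have "set_integrable lborel {0..t} (\<lambda>_. 1 :: real)" "set_integrable lborel {0..t} (indicat_real {s<..<e})"
      unfolding set_integrable_def
      using e by (auto simp: emeasure_lborel_Icc_eq indicator_inter_arith[symmetric] intro!: integrable_real_indicator)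
    then show "set_integrable lborel {0..t} (\<lambda>\<tau>. 1 - indicat_real {s<..<e} \<tau>)"
      by (rule set_integral_diff)
    show "of_bool (odd (heading (N \<tau> \<omega>) \<omega>)) \<le> (1 - indicator {s<..<e} \<tau> :: real)" for \<tau>
      using b(2)[of \<tau>] even by (auto simp: e_def indicator_def)
  qed
  also have "\<dots> = t - (e - s)"
  proof -
    have "(LINT \<tau>:{0..t}|lborel. 1 - indicator {s<..<e} \<tau>) = (LINT \<tau>|lborel. indicat_real {0..t} \<tau> - indicat_real {s<..<e} \<tau>)"
      unfolding set_lebesgue_integral_def using e s by (intro Bochner_Integration.integral_cong) (auto simp: indicator_def)
    also have "\<dots> = (LINT \<tau>|lborel. indicat_real {0..t} \<tau>) - (LINT \<tau>|lborel. indicat_real {s<..<e} \<tau>)"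
      using e s by (intro Bochner_Integration.integral_diff integrable_real_indicator) auto
    finally show ?thesis using e s by simp
  qed
  finally show False using e by simp
qed

text \<open>The number n is a parameter and not the random count, so the event depends on the
  initial index and the turns alone and is independent of the clock.\<close>

definition always_reflected :: "int \<Rightarrow> nat \<Rightarrow> 'a set" where
  "always_reflected j n = {\<omega> \<in> space M. J0 \<omega> = j \<and> (\<forall>k<n. \<xi> k \<omega> = 2)}"

lemma heading_always_reflected:
  "\<omega> \<in> always_reflected j n \<Longrightarrow> m \<le> n \<Longrightarrow> heading m \<omega> = j + 2 * int m"
  by (simp add: always_reflected_def heading_def)

text \<open>The three prescribed probabilities add up to one, so all other integer values have
  probability zero.\<close>

lemma AE_turns: "AE \<omega> in M. \<forall>k. \<xi> k \<omega> \<in> {1, -1, 2}"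
  unfolding AE_all_countable
proof
  fix k
  have m: "{\<omega> \<in> space M. \<xi> k \<omega> = a} \<in> events" for a
    using measurable_sets[OF turn_random_variable[of k], of "{a}"] by (simp add: vimage_def Int_def conj_commute)
  have "{\<omega> \<in> space M. \<xi> k \<omega> \<in> {1, -1, 2}}
      = {\<omega> \<in> space M. \<xi> k \<omega> = 1} \<union> ({\<omega> \<in> space M. \<xi> k \<omega> = -1} \<union> {\<omega> \<in> space M. \<xi> k \<omega> = 2})" by auto
  then have "prob {\<omega> \<in> space M. \<xi> k \<omega> \<in> {1, -1, 2}} = p + (q + (1 - p - q))"
    using m turn_left[of k] turn_right[of k] turn_back[of k]
    by (simp only:) (subst finite_measure_Union, auto)+
  then show "AE \<omega> in M. \<xi> k \<omega> \<in> {1, -1, 2}"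
    using m by (subst prob_Collect_eq_1[symmetric]) (auto intro: AE_prob_1 prob_Collect_eq_1[THEN iffD1])
qed

lemma prob_J0: "j \<in> {0, 1, 2, 3} \<Longrightarrow> prob {\<omega> \<in> space M. J0 \<omega> = j} = 1 / 4"
proof -
  assume j: "j \<in> {0, 1, 2, 3}"
  have "prob {\<omega> \<in> space M. J0 \<omega> = j} = measure (distr M (count_space UNIV) J0) {j}"
    using J0_random_variable by (subst measure_distr) (auto intro!: arg_cong2[where f=measure])
  then show ?thesis using j unfolding J0_distr by (auto simp: measure_pmf_single pmf_of_set)
qed

lemma AE_J0: "AE \<omega> in M. J0 \<omega> \<in> {0, 1, 2, 3}"
proof -
  have "AE j in distr M (count_space UNIV) J0. j \<in> {0, 1, 2, 3}"
    unfolding J0_distr by (auto simp: AE_measure_pmf_iff)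
  then show ?thesis using J0_random_variable by (subst (asm) AE_distr_iff) auto
qed

text \<open>If the motion is vertical throughout, each heading up to N(t) is visited before t and so
  is odd; consecutive odd headings differ by an even turn, and 2 is the only even value among 1, -1
  and 2. Conversely an odd start followed by reflections keeps every heading odd.\<close>

lemma AE_always_vertical_iff:
  assumes "0 < t"
  shows "AE \<omega> in M. vertical_time (direction J0 N \<xi>) t \<omega> = t \<longleftrightarrow>
    \<omega> \<in> always_reflected 1 (N t \<omega>) \<or> \<omega> \<in> always_reflected 3 (N t \<omega>)"
  using AE_attains_all_values[OF assms] AE_turns AE_J0 AE_space
proof eventually_elim
  case (elim \<omega>)
  show ?case
  proof
    assume T: "vertical_time (direction J0 N \<xi>) t \<omega> = t"
    have odd: "odd (heading m \<omega>)" if "m \<le> N t \<omega>" for m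
      using elim(1) that vertical_until[OF elim(4) T] by blast
    have "odd (J0 \<omega>)" using odd[of 0] by (simp add: heading_def)
    moreover have "\<xi> k \<omega> = 2" if "k < N t \<omega>" for k
    proof -
      have "heading (Suc k) \<omega> = heading k \<omega> + \<xi> k \<omega>" by (simp add: heading_def)
      then have "even (\<xi> k \<omega>)" using odd[of k] odd[of "Suc k"] that by simp
      then show ?thesis using elim(2)[rule_format, of k] by auto
    qed
    ultimately show "\<omega> \<in> always_reflected 1 (N t \<omega>) \<or> \<omega> \<in> always_reflected 3 (N t \<omega>)"
      using elim(3,4) by (auto simp: always_reflected_def)
  next
    assume "\<omega> \<in> always_reflected 1 (N t \<omega>) \<or> \<omega> \<in> always_reflected 3 (N t \<omega>)"
    then obtain j where j: "odd j" "\<omega> \<in> always_reflected j (N t \<omega>)"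
      by (metis odd_numeral odd_one)
    have "(LINT \<tau>:{0..t}|lborel. of_bool (odd (heading (N \<tau> \<omega>) \<omega>))) = (LINT \<tau>:{0..t}|lborel. (1::real))"
      using j heading_always_reflected[OF j(2)] N_mono[OF elim(4)]
      by (intro set_lebesgue_integral_cong) auto
    then show "vertical_time (direction J0 N \<xi>) t \<omega> = t"
      using assms by (simp add: vertical_time_eq set_lebesgue_integral_def)
  qed
qed

text \<open>Each reflection is a half-turn and flips the vertical component; the initial sine is 1
  for j = 1 and -1 for j = 3.\<close>

lemma snd_position_always_reflected:
  assumes "\<omega> \<in> always_reflected j (N t \<omega>)"
  shows "snd (position c (direction J0 N \<xi>) t \<omega>) = c * sin (pi * of_int j / 2) * alternating_integral t \<omega>"
proof -
  have \<omega>: "\<omega> \<in> space M" using assms by (simp add: always_reflected_def)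
  have "(LINT \<tau>:{0..t}|lborel. sin (pi * of_int (heading (N \<tau> \<omega>) \<omega>) / 2))
      = (LINT \<tau>:{0..t}|lborel. sin (pi * of_int j / 2) * (- 1) ^ N \<tau> \<omega>)"
    using heading_always_reflected[OF assms] N_mono[OF \<omega>]
    by (intro set_lebesgue_integral_cong) (auto simp: sin_half_turns simp del: of_int_add)
  then show ?thesis unfolding snd_position[OF \<omega>] by (simp add: alternating_integral_def)
qed

section \<open>Independence of the reflections from the clock\<close>

lemma always_reflected_measurable: "always_reflected j n \<in> events"
proof (induction n)
  case 0
  have "always_reflected j 0 = J0 -` {j} \<inter> space M" by (auto simp: always_reflected_def)
  then show ?case using measurable_sets[OF J0_random_variable, of "{j}"] by simp
next
  case (Suc n)
  have "always_reflected j (Suc n) = always_reflected j n \<inter> (\<xi> n -` {2} \<inter> space M)"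
    by (auto simp: always_reflected_def less_Suc_eq)
  then show ?case using Suc measurable_sets[OF turn_random_variable[of n], of "{2}"] by simp
qed

text \<open>One event is chosen from each of n + 2 independent sources: the clock, the initial index
  and the first n turns.\<close>

lemma prob_clock_Int_always_reflected:
  assumes j: "j \<in> {0, 1, 2, 3}" and a: "a \<in> sets clock"
  shows "prob (a \<inter> always_reflected j n) = prob a * ((1 - p - q) ^ n / 4)"
proof -
  define F where "F i = (case i of Initial \<Rightarrow> J0 -` {j} \<inter> space M | Clock \<Rightarrow> a | Turn k \<Rightarrow> \<xi> k -` {2} \<inter> space M)" for i
  define I where "I = insert Clock (insert Initial (Turn ` {..<n}))"
  have "a \<subseteq> space M" using sets.sets_into_space[OF a] by simp
  then have "a \<inter> always_reflected j n = (\<Inter>i\<in>I. F i)"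
    by (auto simp: I_def F_def always_reflected_def)
  moreover have "prob (\<Inter>i\<in>I. F i) = (\<Prod>i\<in>I. prob (F i))"
    using a by (intro indep_setsD[OF sources_indep])
      (auto simp: I_def F_def sets_clock)
  moreover have "(\<Prod>i\<in>I. prob (F i)) = prob (F Clock) * (prob (F Initial) * (\<Prod>k<n. prob (F (Turn k))))"
    unfolding I_def by (subst prod.insert, simp, force)+ (simp add: prod.reindex inj_on_def)
  moreover have "F Initial = {\<omega> \<in> space M. J0 \<omega> = j}" "F (Turn k) = {\<omega> \<in> space M. \<xi> k \<omega> = 2}" for k
    by (auto simp: F_def)
  ultimately show ?thesis
    using prob_J0[OF j] turn_back by (simp add: F_def)
qed

text \<open>The product rule passes from events to functions: \<open>sets clock\<close> and the
  one-element family are stable under intersection, so independence extends to the generated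
  \<sigma>-algebras, and these contain all preimages under \<open>f\<close> and under the
  indicator.\<close>

lemma expectation_clock_times_always_reflected:
  fixes f :: "'a \<Rightarrow> real"
  assumes j: "j \<in> {0, 1, 2, 3}" and f: "f \<in> borel_measurable clock" and bound: "\<And>\<omega>. \<bar>f \<omega>\<bar> \<le> 1"
  shows "expectation (\<lambda>\<omega>. f \<omega> * indicator (always_reflected j n) \<omega>) = expectation f * ((1 - p - q) ^ n / 4)"
proof -
  let ?B = "always_reflected j n"
  have B: "?B \<in> events" by (rule always_reflected_measurable)
  have pB: "prob ?B = (1 - p - q) ^ n / 4"
    using prob_clock_Int_always_reflected[OF j, of "space M" n] sets.top[of clock] sets.sets_into_space[OF B]
    by (simp add: prob_space Int_absorb1)
  have sub: "sets clock \<subseteq> events" using subalgebra_clock by (simp add: subalgebra_def)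
  have "indep_set (sets clock) {?B}"
    using sub B by (intro indep_setI) (auto simp: prob_clock_Int_always_reflected[OF j] pB)
  then have ind: "indep_set (sigma_sets (space M) (sets clock)) (sigma_sets (space M) {?B})"
    by (rule indep_set_sigma_sets) (auto simp: sets.Int_stable Int_stable_def)
  have fM: "f \<in> borel_measurable M" by (rule measurable_from_subalg[OF subalgebra_clock f])
  have iM: "(indicator ?B :: 'a \<Rightarrow> real) \<in> borel_measurable M" using B by simp
  have s1: "sigma_sets (space M) {f -` A \<inter> space M |A. A \<in> sets borel} \<subseteq> sigma_sets (space M) (sets clock)"
    using measurable_sets[OF f] by (intro sigma_sets_mono) (auto intro: sigma_sets.Basic)
  \<comment> \<open>The indicator is already measurable for the \<sigma>-algebra generated by its
    own set.\<close>
  have s2: "sigma_sets (space M) {(indicator ?B :: 'a \<Rightarrow> real) -` A \<inter> space M |A. A \<in> sets borel} \<subseteq> sigma_sets (space M) {?B}"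
  proof (intro sigma_sets_mono subsetI)
    fix X assume "X \<in> {(indicator ?B :: 'a \<Rightarrow> real) -` A \<inter> space M |A. A \<in> sets borel}"
    then obtain A :: "real set" where A: "A \<in> sets borel" "X = indicator ?B -` A \<inter> space M" by blast
    have "{?B} \<subseteq> Pow (space M)" using sets.sets_into_space[OF B] by simp
    moreover from this have "?B \<in> sets (sigma (space M) {?B})" by simp
    then have "(indicator ?B :: 'a \<Rightarrow> real) \<in> borel_measurable (sigma (space M) {?B})" by simp
    from measurable_sets[OF this A(1)] show "X \<in> sigma_sets (space M) {?B}"
      using calculation A(2) by (simp add: space_measure_of)
  qed
  have "indep_var borel f borel (indicator ?B)"
    unfolding indep_var_eq
  proof (intro conjI fM iM indep_setI)
    show "sigma_sets (space M) {f -` A \<inter> space M |A. A \<in> sets borel} \<subseteq> events"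
      using s1 indep_setD_ev1[OF ind] by blast
    show "sigma_sets (space M) {(indicator ?B :: 'a \<Rightarrow> real) -` A \<inter> space M |A. A \<in> sets borel} \<subseteq> events"
      using s2 indep_setD_ev2[OF ind] by blast
  qed (use s1 s2 indep_setD[OF ind] in blast)
  moreover have "integrable M f"
    using fM bound by (intro integrable_const_bound[of _ 1]) auto
  moreover have "integrable M (indicator ?B :: 'a \<Rightarrow> real)" using B by (intro integrable_real_indicator) (auto simp: emeasure_eq_measure)
  ultimately have "expectation (\<lambda>\<omega>. f \<omega> * indicator ?B \<omega>) = expectation f * expectation (indicator ?B)"
    by (rule indep_var_lebesgue_integral)
  then show ?thesis using B by (simp add: pB)
qed

text \<open>Replaces a random index by a sum over its values: the m-th partial sum is the integrand
  restricted to N(t) < m, so dominated convergence applies.\<close>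

lemma expectation_split_count:
  fixes g :: "nat \<Rightarrow> 'a \<Rightarrow> real"
  assumes "0 \<le> t" and g: "\<And>n. g n \<in> borel_measurable M" and bound: "\<And>n \<omega>. \<bar>g n \<omega>\<bar> \<le> 1"
  shows "(\<lambda>n. expectation (\<lambda>\<omega>. g n \<omega> * of_bool (N t \<omega> = n))) sums expectation (\<lambda>\<omega>. g (N t \<omega>) \<omega>)"
proof -
  have Nm [measurable]: "N t \<in> measurable M (count_space UNIV)" using \<open>0 \<le> t\<close> by (rule N_measurable)
  have [measurable]: "g n \<in> borel_measurable M" for n by (rule g)
  have gm: "(\<lambda>\<omega>. g (N t \<omega>) \<omega>) \<in> borel_measurable M"
    by (rule measurable_compose_countable[OF g Nm])
  have eq: "(\<Sum>n<m. g n \<omega> * of_bool (N t \<omega> = n)) = g (N t \<omega>) \<omega> * of_bool (N t \<omega> < m)" for m \<omega>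
    by (induction m) (auto simp: less_Suc_eq)
  have int: "integrable M (\<lambda>\<omega>. g n \<omega> * of_bool (N t \<omega> = n))" for n
    using bound by (intro integrable_const_bound[of _ 1]) auto
  have "(\<lambda>m. expectation (\<lambda>\<omega>. g (N t \<omega>) \<omega> * of_bool (N t \<omega> < m))) \<longlonglongrightarrow> expectation (\<lambda>\<omega>. g (N t \<omega>) \<omega>)"
  proof (rule integral_dominated_convergence[where w="\<lambda>_. 1"])
    show "AE \<omega> in M. (\<lambda>m. g (N t \<omega>) \<omega> * of_bool (N t \<omega> < m)) \<longlonglongrightarrow> g (N t \<omega>) \<omega>"
    proof (intro AE_I2)
      fix \<omega>
      have "eventually (\<lambda>m. g (N t \<omega>) \<omega> = g (N t \<omega>) \<omega> * of_bool (N t \<omega> < m)) sequentially"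
        using eventually_gt_at_top[of "N t \<omega>"] by eventually_elim simp
      then show "(\<lambda>m. g (N t \<omega>) \<omega> * of_bool (N t \<omega> < m)) \<longlonglongrightarrow> g (N t \<omega>) \<omega>"
        by (rule Lim_transform_eventually[OF tendsto_const])
    qed
    show "AE \<omega> in M. norm (g (N t \<omega>) \<omega> * of_bool (N t \<omega> < m)) \<le> 1" for m
      using bound by (intro AE_I2) auto
  qed (use gm in auto)
  moreover have "(\<Sum>n<m. expectation (\<lambda>\<omega>. g n \<omega> * of_bool (N t \<omega> = n)))
      = expectation (\<lambda>\<omega>. g (N t \<omega>) \<omega> * of_bool (N t \<omega> < m))" for m
    unfolding eq[symmetric] by (rule Bochner_Integration.integral_sum[symmetric]) (rule int)
  ultimately show ?thesis unfolding sums_def by (simp only:)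
qed

text \<open>On N(t) = n the random event is the one with fixed index n, and the restriction of
  \<open>f\<close> to N(t) = n is still measurable for the clock. Each value n thus contributes the
  factor (1 - p - q)^n / 4, and summation restores the random exponent.\<close>

lemma expectation_always_reflected:
  fixes f :: "'a \<Rightarrow> real"
  assumes "0 \<le> t" and j: "j \<in> {0, 1, 2, 3}"
    and f: "f \<in> borel_measurable clock" and bound: "\<And>\<omega>. \<bar>f \<omega>\<bar> \<le> 1"
  shows "expectation (\<lambda>\<omega>. f \<omega> * indicator (always_reflected j (N t \<omega>)) \<omega>)
    = expectation (\<lambda>\<omega>. (1 - p - q) ^ N t \<omega> * f \<omega>) / 4"
proof (rule sums_unique2)
  let ?\<mu> = "1 - p - q"
  have \<mu>: "0 \<le> ?\<mu>" "?\<mu> \<le> 1" using p_nonneg q_nonneg pq_le_1 by auto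
  have fM [measurable]: "f \<in> borel_measurable M" by (rule measurable_from_subalg[OF subalgebra_clock f])
  have [measurable]: "always_reflected j n \<in> events" for n by (rule always_reflected_measurable)
  show "(\<lambda>n. expectation (\<lambda>\<omega>. (f \<omega> * indicator (always_reflected j n) \<omega>) * of_bool (N t \<omega> = n)))
      sums expectation (\<lambda>\<omega>. f \<omega> * indicator (always_reflected j (N t \<omega>)) \<omega>)"
    using \<open>0 \<le> t\<close> bound by (intro expectation_split_count) (auto simp: indicator_def)
  have "(\<lambda>n. expectation (\<lambda>\<omega>. (?\<mu> ^ n * f \<omega>) * of_bool (N t \<omega> = n)) / 4)
      sums (expectation (\<lambda>\<omega>. ?\<mu> ^ N t \<omega> * f \<omega>) / 4)"
    using \<open>0 \<le> t\<close> bound \<mu> by (intro sums_divide expectation_split_count) (auto simp: abs_mult power_abs power_le_one intro!: mult_le_one)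
  moreover have "expectation (\<lambda>\<omega>. (f \<omega> * indicator (always_reflected j n) \<omega>) * of_bool (N t \<omega> = n))
      = expectation (\<lambda>\<omega>. (?\<mu> ^ n * f \<omega>) * of_bool (N t \<omega> = n)) / 4" for n
  proof -
    have "(\<lambda>\<omega>. f \<omega> * of_bool (N t \<omega> = n)) \<in> borel_measurable clock"
      using f measurable_compose[OF N_measurable_clock[OF \<open>0 \<le> t\<close>], of "\<lambda>m. of_bool (m = n)" borel]
      by (intro borel_measurable_times) auto
    from expectation_clock_times_always_reflected[OF j this, of n] bound
    have "expectation (\<lambda>\<omega>. f \<omega> * of_bool (N t \<omega> = n) * indicator (always_reflected j n) \<omega>)
      = expectation (\<lambda>\<omega>. f \<omega> * of_bool (N t \<omega> = n)) * (?\<mu> ^ n / 4)"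
      by (auto simp: abs_mult)
    moreover have "expectation (\<lambda>\<omega>. (?\<mu> ^ n * f \<omega>) * of_bool (N t \<omega> = n)) = ?\<mu> ^ n * expectation (\<lambda>\<omega>. f \<omega> * of_bool (N t \<omega> = n))"
      by (simp only: mult.assoc integral_mult_right_zero)
    ultimately show ?thesis by (simp only: mult_ac times_divide_eq_right)
  qed
  ultimately show "(\<lambda>n. expectation (\<lambda>\<omega>. (f \<omega> * indicator (always_reflected j n) \<omega>) * of_bool (N t \<omega> = n)))
      sums (expectation (\<lambda>\<omega>. ?\<mu> ^ N t \<omega> * f \<omega>) / 4)" by (simp only:)
qed

end

subsection \<open>Characteristic functions and the density\<close>

text \<open>Levy's theorem concerns probability laws, whereas the measures here are defective. Both
  are divided by their common mass: one side becomes the law of X conditioned on E, the other a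
  normalised density.\<close>

lemma (in prob_space) sub_density_from_char:
  fixes X :: "'a \<Rightarrow> real" and g :: "real \<Rightarrow> real"
  assumes X: "X \<in> borel_measurable M" and E: "E \<in> events"
    and g: "integrable lborel g" "\<And>y. 0 \<le> g y"
    and char_eq: "\<And>\<beta>. (LINT \<omega>|M. exp (\<i> * of_real (\<beta> * X \<omega>)) * indicator E \<omega>)
      = (LINT y|lborel. exp (\<i> * of_real (\<beta> * y)) * of_real (g y))"
    and A: "A \<in> sets borel"
  shows "prob {\<omega> \<in> E. X \<omega> \<in> A} = (LINT y:A|lborel. g y)"
proof -
  note X[measurable] E[measurable] A[measurable]
  have gm [measurable]: "g \<in> borel_measurable borel" using g(1) by auto
  \<comment> \<open>Frequency 0 compares the total masses.\<close>
  have "(LINT \<omega>|M. complex_of_real (indicator E \<omega>)) = (LINT y|lborel. complex_of_real (g y))"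
    using char_eq[of 0] by (simp add: indicator_def of_bool_def if_distrib cong: if_cong)
  then have total: "prob E = (LINT y|lborel. g y)" using E by simp
  have PE: "prob {\<omega> \<in> E. X \<omega> \<in> A} = (LINT \<omega>|M. indicator E \<omega> * indicator A (X \<omega>))"
  proof -
    have "{\<omega> \<in> E. X \<omega> \<in> A} = E \<inter> (X -` A \<inter> space M)" using sets.sets_into_space[OF E] by auto
    moreover have "\<dots> \<in> events" by measurable
    ultimately have "prob {\<omega> \<in> E. X \<omega> \<in> A} = (LINT \<omega>|M. indicator {\<omega> \<in> E. X \<omega> \<in> A} \<omega>)" by simp
    also have "\<dots> = (LINT \<omega>|M. indicator E \<omega> * indicator A (X \<omega>))"
      by (intro Bochner_Integration.integral_cong) (auto simp: indicator_def)
    finally show ?thesis .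
  qed
  show ?thesis
  proof (cases "prob E = 0")
    \<comment> \<open>Normalisation is impossible here, but \<open>g\<close> is nonnegative with
      integral zero, so both sides vanish.\<close>
    case True
    have "prob {\<omega> \<in> E. X \<omega> \<in> A} \<le> prob E" by (intro finite_measure_mono E) auto
    moreover have "(LINT y:A|lborel. g y) \<le> (LINT y|lborel. g y)" "0 \<le> (LINT y:A|lborel. g y)"
      unfolding set_lebesgue_integral_def using g integrable_mult_indicator[OF _ g(1), of A]
      by (auto intro!: integral_mono simp: indicator_def)
    ultimately show ?thesis using True total by (simp add: measure_le_0_iff)
  next
    case False
    define m where "m = prob E"
    have m: "0 < m" using False by (simp add: m_def zero_less_measure_iff)
    define M0 where "M0 = density M (\<lambda>\<omega>. ennreal (indicator E \<omega> / m))"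
    define M1 where "M1 = distr M0 borel X"
    define M2 where "M2 = density lborel (\<lambda>y. ennreal (g y / m))"
    have "prob_space M0"
    proof (rule prob_spaceI)
      have "emeasure M0 (space M0) = (\<integral>\<^sup>+\<omega>. ennreal (indicator E \<omega> / m) \<partial>M)"
        unfolding M0_def by (subst emeasure_density) (auto intro!: nn_integral_cong)
      also have "\<dots> = ennreal (LINT \<omega>|M. indicator E \<omega> / m)"
        using m by (intro nn_integral_eq_integral) (auto simp: emeasure_eq_measure)
      finally show "emeasure M0 (space M0) = 1" using m E by (simp add: m_def)
    qed
    then have "real_distribution M1"
      unfolding M1_def real_distribution_def real_distribution_axioms_def
      by (auto intro!: prob_space.prob_space_distr simp: M0_def)
    moreover have "real_distribution M2"
      unfolding real_distribution_def real_distribution_axioms_def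
    proof
      show "prob_space M2"
      proof (rule prob_spaceI)
        have "emeasure M2 (space M2) = (\<integral>\<^sup>+y. ennreal (g y / m) \<partial>lborel)"
          unfolding M2_def by (subst emeasure_density) (auto intro!: nn_integral_cong)
        also have "\<dots> = ennreal (LINT y|lborel. g y / m)"
          using m g by (intro nn_integral_eq_integral) auto
        finally show "emeasure M2 (space M2) = 1" using m by (simp add: m_def total)
      qed
    qed (simp add: M2_def)
    moreover have int1: "integral\<^sup>L M1 f = (LINT \<omega>|M. indicator E \<omega> *\<^sub>R f (X \<omega>)) /\<^sub>R m"
      if [measurable]: "f \<in> borel_measurable borel" for f :: "real \<Rightarrow> 'c :: {banach, second_countable_topology}"
    proof -
      have "integral\<^sup>L M1 f = (LINT \<omega>|M0. f (X \<omega>))"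
        unfolding M1_def M0_def by (rule integral_distr) auto
      also have "\<dots> = (LINT \<omega>|M. (indicator E \<omega> / m) *\<^sub>R f (X \<omega>))"
        unfolding M0_def using m by (subst integral_density) auto
      also have "\<dots> = (LINT \<omega>|M. inverse m *\<^sub>R (indicator E \<omega> *\<^sub>R f (X \<omega>)))"
        by (intro Bochner_Integration.integral_cong) (auto simp: field_simps)
      finally show ?thesis by (simp only: integral_scaleR_right)
    qed
    moreover have int2: "integral\<^sup>L M2 f = (LINT y|lborel. g y *\<^sub>R f y) /\<^sub>R m"
      if [measurable]: "f \<in> borel_measurable borel" for f :: "real \<Rightarrow> 'c :: {banach, second_countable_topology}"
    proof -
      have "integral\<^sup>L M2 f = (LINT y|lborel. (g y / m) *\<^sub>R f y)"
        unfolding M2_def using m g by (subst integral_density) auto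
      also have "\<dots> = (LINT y|lborel. inverse m *\<^sub>R (g y *\<^sub>R f y))"
        by (intro Bochner_Integration.integral_cong) (auto simp: field_simps)
      finally show ?thesis by (simp only: integral_scaleR_right)
    qed
    have "char M1 \<beta> = char M2 \<beta>" for \<beta>
    proof -
      have "(LINT \<omega>|M. indicator E \<omega> *\<^sub>R exp (\<i> * of_real (\<beta> * X \<omega>)))
          = (LINT \<omega>|M. exp (\<i> * of_real (\<beta> * X \<omega>)) * indicator E \<omega>)"
        by (intro Bochner_Integration.integral_cong) (auto simp: indicator_def)
      also have "\<dots> = (LINT y|lborel. g y *\<^sub>R exp (\<i> * of_real (\<beta> * y)))"
        unfolding char_eq by (intro Bochner_Integration.integral_cong) (auto simp: scaleR_conv_of_real)
      finally show ?thesis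
        unfolding char_def by (subst int1, simp, subst int2, simp, simp)
    qed
    ultimately have "M1 = M2" by (intro Levy_uniqueness) auto
    then have "(LINT \<omega>|M. indicator E \<omega> *\<^sub>R indicator A (X \<omega>)) /\<^sub>R m = (LINT y|lborel. g y *\<^sub>R indicat_real A y) /\<^sub>R m"
      using int1[of "indicat_real A"] int2[of "indicat_real A"] by simp
    then show ?thesis
      unfolding PE set_lebesgue_integral_def using m by (simp add: mult.commute)
  qed
qed

lemma lborel_integral_odd:
  fixes f :: "real \<Rightarrow> real"
  assumes "\<And>y. f (- y) = - f y"
  shows "(LINT y|lborel. f y) = 0"
  using lborel_integral_real_affine[of "-1" f 0] assms by simp

section \<open>Transforms of the vertical displacement\<close>

context turning_motion
begin

text \<open>Initial indices 1 and 3 give opposite displacements with equal weights: the sines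
  cancel, the cosines add, and two quarters make the factor 1 / 2. The set K lets one computation
  serve both the full event and its part with at least one Poisson event.\<close>

lemma char_vertical_count:
  assumes "0 < t"
  shows "(LINT \<omega>|M. exp (\<i> * of_real (\<beta> * snd (position c (direction J0 N \<xi>) t \<omega>)))
        * indicator {\<omega> \<in> space M. vertical_time (direction J0 N \<xi>) t \<omega> = t \<and> N t \<omega> \<in> K} \<omega>)
    = of_real (expectation (\<lambda>\<omega>. (1 - p - q) ^ N t \<omega> * (cos (\<beta> * c * alternating_integral t \<omega>) * of_bool (N t \<omega> \<in> K))) / 2)"
proof -
  define Y where "Y \<omega> = snd (position c (direction J0 N \<xi>) t \<omega>)" for \<omega>
  define T where "T = vertical_time (direction J0 N \<xi>) t"
  define f where "f \<omega> = cos (\<beta> * c * alternating_integral t \<omega>) * of_bool (N t \<omega> \<in> K)" for \<omega>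
  define g where "g \<omega> = sin (\<beta> * c * alternating_integral t \<omega>) * of_bool (N t \<omega> \<in> K)" for \<omega>
  define R where "R j \<omega> = indicat_real (always_reflected j (N t \<omega>)) \<omega>" for j \<omega>
  have t: "0 \<le> t" using assms by simp
  have [measurable]: "Y \<in> borel_measurable M" "T \<in> borel_measurable M" "N t \<in> measurable M (count_space UNIV)"
    unfolding Y_def[abs_def] T_def using t by (auto intro: snd_position_measurable vertical_time_measurable N_measurable)
  have fg: "f \<in> borel_measurable clock" "g \<in> borel_measurable clock"
  proof -
    note [measurable] = alternating_integral_measurable_clock[OF t] N_measurable_clock[OF t]
    show "f \<in> borel_measurable clock" "g \<in> borel_measurable clock"
      unfolding f_def[abs_def] g_def[abs_def] by measurable
  qed
  have fgM [measurable]: "f \<in> borel_measurable M" "g \<in> borel_measurable M"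
    using fg by (auto intro: measurable_from_subalg[OF subalgebra_clock])
  have RM [measurable]: "R j \<in> borel_measurable M" for j
    unfolding R_def[abs_def]
    by (rule measurable_compose_countable[OF _ N_measurable[OF t]])
      (intro borel_measurable_indicator always_reflected_measurable)
  have b: "\<bar>f \<omega>\<bar> \<le> 1" "\<bar>g \<omega>\<bar> \<le> 1" for \<omega> by (auto simp: f_def g_def)
  have int: "integrable M (\<lambda>\<omega>. f \<omega> * R j \<omega>)" "integrable M (\<lambda>\<omega>. g \<omega> * R j \<omega>)" for j
  proof -
    have "\<bar>f \<omega> * R j \<omega>\<bar> \<le> 1" "\<bar>g \<omega> * R j \<omega>\<bar> \<le> 1" for \<omega>
      using b[of \<omega>] by (auto simp: R_def indicator_def)
    then show "integrable M (\<lambda>\<omega>. f \<omega> * R j \<omega>)" "integrable M (\<lambda>\<omega>. g \<omega> * R j \<omega>)"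
      by (auto intro!: integrable_const_bound[of _ 1])
  qed
  have sin3: "sin (pi * 3 / 2) = - 1" using sin_add[of pi "pi / 2"] by (simp add: field_simps)
  have "(LINT \<omega>|M. exp (\<i> * of_real (\<beta> * Y \<omega>)) * indicator {\<omega> \<in> space M. T \<omega> = t \<and> N t \<omega> \<in> K} \<omega>)
    = (LINT \<omega>|M. complex_of_real (f \<omega> * R 1 \<omega> + f \<omega> * R 3 \<omega>) + \<i> * complex_of_real (g \<omega> * R 1 \<omega> - g \<omega> * R 3 \<omega>))"
  proof (rule integral_cong_AE)
    show "AE \<omega> in M. exp (\<i> * of_real (\<beta> * Y \<omega>)) * indicator {\<omega> \<in> space M. T \<omega> = t \<and> N t \<omega> \<in> K} \<omega>
      = complex_of_real (f \<omega> * R 1 \<omega> + f \<omega> * R 3 \<omega>) + \<i> * complex_of_real (g \<omega> * R 1 \<omega> - g \<omega> * R 3 \<omega>)"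
      using AE_always_vertical_iff[OF assms] AE_space
    proof eventually_elim
      case (elim \<omega>)
      have e: "exp (\<i> * complex_of_real x) = of_real (cos x) + \<i> * of_real (sin x)" for x
        by (simp add: exp_Euler cos_of_real sin_of_real)
      consider "\<omega> \<in> always_reflected 1 (N t \<omega>)" | "\<omega> \<in> always_reflected 3 (N t \<omega>)"
        | "\<omega> \<notin> always_reflected 1 (N t \<omega>)" "\<omega> \<notin> always_reflected 3 (N t \<omega>)" by blast
      then show ?case
      proof cases
        case 1
        moreover have "Y \<omega> = c * alternating_integral t \<omega>"
          unfolding Y_def using snd_position_always_reflected[OF 1] by simp
        moreover have "\<omega> \<notin> always_reflected 3 (N t \<omega>)" using 1 by (simp add: always_reflected_def)
        ultimately show ?thesis using elim unfolding e T_def[symmetric]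
          by (simp add: R_def f_def g_def indicator_def mult.assoc)
      next
        case 2
        moreover have "Y \<omega> = - (c * alternating_integral t \<omega>)"
          unfolding Y_def using snd_position_always_reflected[OF 2] by (simp add: sin3)
        moreover have "\<omega> \<notin> always_reflected 1 (N t \<omega>)" using 2 by (simp add: always_reflected_def)
        ultimately show ?thesis using elim unfolding e T_def[symmetric]
          by (simp add: R_def f_def g_def indicator_def mult.assoc)
      next
        case 3
        then show ?thesis using elim unfolding T_def[symmetric] by (simp add: R_def)
      qed
    qed
  qed measurable
  also have "\<dots> = of_real (expectation (\<lambda>\<omega>. f \<omega> * R 1 \<omega>) + expectation (\<lambda>\<omega>. f \<omega> * R 3 \<omega>))
      + \<i> * of_real (expectation (\<lambda>\<omega>. g \<omega> * R 1 \<omega>) - expectation (\<lambda>\<omega>. g \<omega> * R 3 \<omega>))"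
    using int by (subst Bochner_Integration.integral_add) (auto simp del: of_real_add of_real_diff of_real_mult)
  also have "\<dots> = of_real (expectation (\<lambda>\<omega>. (1 - p - q) ^ N t \<omega> * f \<omega>) / 2)"
  proof -
    have *: "expectation (\<lambda>\<omega>. f \<omega> * R j \<omega>) = expectation (\<lambda>\<omega>. (1 - p - q) ^ N t \<omega> * f \<omega>) / 4"
      "expectation (\<lambda>\<omega>. g \<omega> * R j \<omega>) = expectation (\<lambda>\<omega>. (1 - p - q) ^ N t \<omega> * g \<omega>) / 4"
      if "j \<in> {0, 1, 2, 3}" for j
      unfolding R_def
      by (rule expectation_always_reflected[OF t that fg(1) b(1)], rule expectation_always_reflected[OF t that fg(2) b(2)])
    have j: "1 \<in> {0, 1, 2, 3 :: int}" "3 \<in> {0, 1, 2, 3 :: int}" by simp_all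
    show ?thesis unfolding *[OF j(1)] *[OF j(2)] by simp
  qed
  finally show ?thesis unfolding Y_def T_def f_def .
qed

lemma char_vertical:
  assumes "0 < t"
  shows "(LINT \<omega>|M. exp (\<i> * of_real (\<beta> * snd (position c (direction J0 N \<xi>) t \<omega>)))
        * indicator {\<omega> \<in> space M. vertical_time (direction J0 N \<xi>) t \<omega> = t} \<omega>)
    = of_real (exp (- lambda * t) / 2 * (cosh_root (t\<^sup>2 * ((lambda * (1 - p - q))\<^sup>2 - (\<beta> * c)\<^sup>2))
        + lambda * (1 - p - q) * t * sinhc_root (t\<^sup>2 * ((lambda * (1 - p - q))\<^sup>2 - (\<beta> * c)\<^sup>2))))"
  using char_vertical_count[OF assms, of \<beta> c UNIV]
    expectation_telegraph[OF assms, of "1 - p - q" "\<beta> * c"] p_nonneg q_nonneg pq_le_1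
  by simp

lemma alternating_integral_no_event:
  assumes "\<omega> \<in> space M" "N t \<omega> = 0" "0 \<le> t"
  shows "alternating_integral t \<omega> = t"
proof -
  have "alternating_integral t \<omega> = (LINT \<tau>:{0..t}|lborel. 1)"
    unfolding alternating_integral_def
  proof (rule set_lebesgue_integral_cong)
    show "\<forall>\<tau>. \<tau> \<in> {0..t} \<longrightarrow> (- 1) ^ N \<tau> \<omega> = (1::real)"
      using N_mono[OF assms(1)] assms(2) by (metis atLeastAtMost_iff le_zero_eq power_0)
  qed simp
  then show ?thesis using assms by (simp add: set_lebesgue_integral_def)
qed

text \<open>Without a Poisson event the alternating integral is t, so the part removed has transform
  exp(-lambda t) cos(\<beta> c t) / 2: two atoms, each of mass exp(-lambda t) / 4.\<close>

lemma char_vertical_moved: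
  assumes "0 < t"
  shows "(LINT \<omega>|M. exp (\<i> * of_real (\<beta> * snd (position c (direction J0 N \<xi>) t \<omega>)))
        * indicator {\<omega> \<in> space M. vertical_time (direction J0 N \<xi>) t \<omega> = t \<and> N t \<omega> \<in> {1..}} \<omega>)
    = of_real (exp (- lambda * t) / 2 * (cosh_root (t\<^sup>2 * ((lambda * (1 - p - q))\<^sup>2 - (\<beta> * c)\<^sup>2))
        + lambda * (1 - p - q) * t * sinhc_root (t\<^sup>2 * ((lambda * (1 - p - q))\<^sup>2 - (\<beta> * c)\<^sup>2)) - cos (\<beta> * c * t)))"
proof -
  let ?\<mu> = "1 - p - q"
  have \<mu>: "0 \<le> ?\<mu>" "?\<mu> \<le> 1" using p_nonneg q_nonneg pq_le_1 by auto
  have [measurable]: "N t \<in> measurable M (count_space UNIV)" using assms by (intro N_measurable) simp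
  have [measurable]: "alternating_integral t \<in> borel_measurable M"
    using assms by (intro measurable_from_subalg[OF subalgebra_clock] alternating_integral_measurable_clock) simp
  have i1: "integrable M (\<lambda>\<omega>. ?\<mu> ^ N t \<omega> * cos (\<beta> * c * alternating_integral t \<omega>))"
    using \<mu> by (intro integrable_const_bound[of _ 1]) (auto simp: abs_mult power_abs power_le_one intro!: mult_le_one)
  \<comment> \<open>The power of 0 is the indicator of no event up to t, written so that its mean is
    a generating function at 0.\<close>
  have i2: "integrable M (\<lambda>\<omega>. cos (\<beta> * c * t) * 0 ^ (N t \<omega> - N 0 \<omega>))"
  proof (intro integrable_mult_right integrable_const_bound[of _ 1] AE_I2)
    show "(\<lambda>\<omega>. 0 ^ (N t \<omega> - N 0 \<omega>) :: real) \<in> borel_measurable M"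
      using assms by (intro measurable_compose[OF increment_measurable]) auto
  qed (simp add: power_0_left)
  have "expectation (\<lambda>\<omega>. ?\<mu> ^ N t \<omega> * (cos (\<beta> * c * alternating_integral t \<omega>) * of_bool (N t \<omega> \<in> {1..})))
      = expectation (\<lambda>\<omega>. ?\<mu> ^ N t \<omega> * cos (\<beta> * c * alternating_integral t \<omega>) - cos (\<beta> * c * t) * 0 ^ (N t \<omega> - N 0 \<omega>))"
    using assms by (intro Bochner_Integration.integral_cong) (auto simp: N_zero power_0_left alternating_integral_no_event)
  also have "\<dots> = expectation (\<lambda>\<omega>. ?\<mu> ^ N t \<omega> * cos (\<beta> * c * alternating_integral t \<omega>)) - cos (\<beta> * c * t) * exp (- lambda * t)"
    using expectation_increment_power[of 0 t 0] assms
    by (subst Bochner_Integration.integral_diff[OF i1 i2]) simp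
  also have "\<dots> / 2 = exp (- lambda * t) / 2 * (cosh_root (t\<^sup>2 * ((lambda * (1 - p - q))\<^sup>2 - (\<beta> * c)\<^sup>2))
        + lambda * (1 - p - q) * t * sinhc_root (t\<^sup>2 * ((lambda * (1 - p - q))\<^sup>2 - (\<beta> * c)\<^sup>2)) - cos (\<beta> * c * t))"
  proof -
    have "(e * z - x * e) / 2 = e / 2 * (z - x)" for e z x :: real by (simp add: algebra_simps)
    then show ?thesis unfolding expectation_telegraph[OF assms \<mu>] .
  qed
  finally show ?thesis unfolding char_vertical_count[OF assms] by (simp only:)
qed

end

section \<open>The Bessel density and the exponential form\<close>

text \<open>The two transforms are taken at L = c t, where L^2 (4 w - \<beta>^2) = t^2 (a^2 -
  \<beta>^2 c^2). The term with \<open>bessel_B'\<close> is the time derivative of the kernel, and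
  its subtracted cosine matches the removed atoms.\<close>

lemma integral_telegraph_density:
  fixes a c t \<beta> :: real
  assumes "0 < c" "0 < t"
  defines "w \<equiv> (a / (2 * c))\<^sup>2"
  shows "(LINT y:{- (c * t)..c * t}|lborel. (a * bessel_B (w * ((c * t)\<^sup>2 - y\<^sup>2))
            + w * (2 * c\<^sup>2 * t) * bessel_B' (w * ((c * t)\<^sup>2 - y\<^sup>2))) * cos (\<beta> * y))
    = 2 * c * (cosh_root (t\<^sup>2 * (a\<^sup>2 - (\<beta> * c)\<^sup>2)) + a * t * sinhc_root (t\<^sup>2 * (a\<^sup>2 - (\<beta> * c)\<^sup>2))
        - cos (\<beta> * c * t))"
proof -
  let ?L = "c * t"
  have L: "0 \<le> ?L" using assms by simp
  have arg: "?L\<^sup>2 * (4 * w - \<beta>\<^sup>2) = t\<^sup>2 * (a\<^sup>2 - (\<beta> * c)\<^sup>2)"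
    using assms by (simp add: w_def power2_eq_square field_simps)
  have int: "set_integrable lborel {- ?L..?L} (\<lambda>y. bessel_B (w * (?L\<^sup>2 - y\<^sup>2)) * cos (\<beta> * y))"
    "set_integrable lborel {- ?L..?L} (\<lambda>y. bessel_B' (w * (?L\<^sup>2 - y\<^sup>2)) * cos (\<beta> * y))"
    by (intro borel_integrable_atLeastAtMost' continuous_intros)+
  have "(LINT y:{- ?L..?L}|lborel. (a * bessel_B (w * (?L\<^sup>2 - y\<^sup>2))
            + w * (2 * c\<^sup>2 * t) * bessel_B' (w * (?L\<^sup>2 - y\<^sup>2))) * cos (\<beta> * y))
    = (LINT y:{- ?L..?L}|lborel. a * (bessel_B (w * (?L\<^sup>2 - y\<^sup>2)) * cos (\<beta> * y))
            + w * (2 * c\<^sup>2 * t) * (bessel_B' (w * (?L\<^sup>2 - y\<^sup>2)) * cos (\<beta> * y)))"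
    by (simp only: distrib_right mult.assoc)
  also have "\<dots> = a * (LINT y:{- ?L..?L}|lborel. bessel_B (w * (?L\<^sup>2 - y\<^sup>2)) * cos (\<beta> * y))
      + 2 * c * (?L * w * (LINT y:{- ?L..?L}|lborel. bessel_B' (w * (?L\<^sup>2 - y\<^sup>2)) * cos (\<beta> * y)))"
    using int by (subst set_integral_add) (auto simp: power2_eq_square)
  also have "\<dots> = a * (2 * ?L * sinhc_root (t\<^sup>2 * (a\<^sup>2 - (\<beta> * c)\<^sup>2)))
      + 2 * c * (cosh_root (t\<^sup>2 * (a\<^sup>2 - (\<beta> * c)\<^sup>2)) - cos (\<beta> * ?L))"
    unfolding bessel_B_cos_transform[OF L] bessel_B'_cos_transform[OF L] arg ..
  finally show ?thesis by (simp add: algebra_simps)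
qed

text \<open>The condition |y| < c s is open in s, so near t the radicand is positive and the square
  root disappears into the smooth \<open>bessel_B\<close>; the derivative is then the chain
  rule.\<close>

lemma bessel_I_deriv:
  fixes k c t y :: real
  assumes "\<bar>y\<bar> < c * t"
  shows "deriv (\<lambda>s. bessel_I 0 (k * sqrt (c\<^sup>2 * s\<^sup>2 - y\<^sup>2))) t
    = (k / 2)\<^sup>2 * (2 * c\<^sup>2 * t) * bessel_B' ((k / 2)\<^sup>2 * ((c * t)\<^sup>2 - y\<^sup>2))"
    and "bessel_I 0 (k * sqrt (c\<^sup>2 * t\<^sup>2 - y\<^sup>2)) = bessel_B ((k / 2)\<^sup>2 * ((c * t)\<^sup>2 - y\<^sup>2))"
proof -
  have eq: "bessel_I 0 (k * sqrt (c\<^sup>2 * s\<^sup>2 - y\<^sup>2)) = bessel_B ((k / 2)\<^sup>2 * ((c * s)\<^sup>2 - y\<^sup>2))"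
    if "\<bar>y\<bar> < c * s" for s
  proof -
    have "y\<^sup>2 \<le> (c * s)\<^sup>2" using that by (intro abs_le_square_iff[THEN iffD1]) auto
    then show ?thesis by (simp add: bessel_I_0 power_mult_distrib power_divide)
  qed
  show "bessel_I 0 (k * sqrt (c\<^sup>2 * t\<^sup>2 - y\<^sup>2)) = bessel_B ((k / 2)\<^sup>2 * ((c * t)\<^sup>2 - y\<^sup>2))"
    by (rule eq[OF assms])
  have "isCont (\<lambda>s. c * s) t" by (intro continuous_intros)
  then have "eventually (\<lambda>s. \<bar>y\<bar> < c * s) (nhds t)"
    using assms by (auto simp: continuous_at_imp_continuous_on isCont_def tendsto_at_iff_tendsto_nhds dest: order_tendstoD(1))
  then have ev: "eventually (\<lambda>s. bessel_I 0 (k * sqrt (c\<^sup>2 * s\<^sup>2 - y\<^sup>2)) = bessel_B ((k / 2)\<^sup>2 * ((c * s)\<^sup>2 - y\<^sup>2))) (nhds t)"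
    by (rule eventually_mono) (rule eq)
  have inner: "((\<lambda>s. (k / 2)\<^sup>2 * ((c * s)\<^sup>2 - y\<^sup>2)) has_real_derivative (k / 2)\<^sup>2 * (2 * c\<^sup>2 * t)) (at t)"
    by (auto intro!: derivative_eq_intros simp: power2_eq_square)
  have "((\<lambda>s. bessel_B ((k / 2)\<^sup>2 * ((c * s)\<^sup>2 - y\<^sup>2))) has_real_derivative
      bessel_B' ((k / 2)\<^sup>2 * ((c * t)\<^sup>2 - y\<^sup>2)) * ((k / 2)\<^sup>2 * (2 * c\<^sup>2 * t))) (at t)"
    by (rule DERIV_chain2[OF bessel_B_deriv inner])
  then have "((\<lambda>s. bessel_I 0 (k * sqrt (c\<^sup>2 * s\<^sup>2 - y\<^sup>2))) has_real_derivative
      bessel_B' ((k / 2)\<^sup>2 * ((c * t)\<^sup>2 - y\<^sup>2)) * ((k / 2)\<^sup>2 * (2 * c\<^sup>2 * t))) (at t)"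
    by (subst DERIV_cong_ev[OF refl ev refl])
  then show "deriv (\<lambda>s. bessel_I 0 (k * sqrt (c\<^sup>2 * s\<^sup>2 - y\<^sup>2))) t
    = (k / 2)\<^sup>2 * (2 * c\<^sup>2 * t) * bessel_B' ((k / 2)\<^sup>2 * ((c * t)\<^sup>2 - y\<^sup>2))"
    by (subst DERIV_imp_deriv) (auto simp: mult.commute)
qed

text \<open>Changing R into -R exchanges the two summands, so the expression is even in R and any
  nonzero root may be used.\<close>

lemma cosh_sinhc_root_exp:
  fixes R :: complex
  assumes R: "R\<^sup>2 = of_real \<rho>" "R \<noteq> 0"
  shows "(1 + of_real a / R) * exp (of_real t * R) + (1 - of_real a / R) * exp (- of_real t * R)
    = of_real (2 * (cosh_root (t\<^sup>2 * \<rho>) + a * t * sinhc_root (t\<^sup>2 * \<rho>)))"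
proof -
  have sq: "(of_real t * R)\<^sup>2 = of_real (t\<^sup>2 * \<rho>)" by (simp add: power_mult_distrib R)
  have "of_real (2 * (cosh_root (t\<^sup>2 * \<rho>) + a * t * sinhc_root (t\<^sup>2 * \<rho>)))
      = 2 * cosh (of_real t * R) + 2 * of_real a / R * sinh (of_real t * R)"
    unfolding cosh_root_square[OF sq, symmetric] sinhc_root_square[OF sq, symmetric]
    using R(2) by simp
  also have "\<dots> = (exp (of_real t * R) + exp (- (of_real t * R))) + of_real a / R * (exp (of_real t * R) - exp (- (of_real t * R)))"
    unfolding cosh_def sinh_def by (simp add: scaleR_conv_of_real)
  also have "\<dots> = (1 + of_real a / R) * exp (of_real t * R) + (1 - of_real a / R) * exp (- of_real t * R)"
    by (simp add: algebra_simps)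
  finally show ?thesis by (rule sym)
qed

section \<open>The density on the open interval\<close>

context turning_motion
begin

text \<open>A set inside the open interval misses both endpoints, so only paths with at least one
  Poisson event count. Their transform has no atomic part and equals that of the Bessel density on
  the closed interval.\<close>

lemma joint_density_vertical:
  assumes "0 < c" "0 < t"
  defines "a \<equiv> lambda * (1 - p - q)"
  defines "w \<equiv> (a / (2 * c))\<^sup>2"
  assumes A: "A \<in> sets borel" "A \<subseteq> {- (c * t)<..<c * t}"
  shows "{\<omega> \<in> space M. snd (position c (direction J0 N \<xi>) t \<omega>) \<in> A \<and> vertical_time (direction J0 N \<xi>) t \<omega> = t} \<in> events"
    and "prob {\<omega> \<in> space M. snd (position c (direction J0 N \<xi>) t \<omega>) \<in> A \<and> vertical_time (direction J0 N \<xi>) t \<omega> = t}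
      = (LINT y:A|lborel. exp (- lambda * t) / (4 * c) * (a * bessel_B (w * ((c * t)\<^sup>2 - y\<^sup>2))
            + w * (2 * c\<^sup>2 * t) * bessel_B' (w * ((c * t)\<^sup>2 - y\<^sup>2))))"
proof -
  define Y where "Y \<omega> = snd (position c (direction J0 N \<xi>) t \<omega>)" for \<omega>
  define T where "T = vertical_time (direction J0 N \<xi>) t"
  define E where "E = {\<omega> \<in> space M. T \<omega> = t \<and> N t \<omega> \<in> {1..}}"
  define G where "G y = exp (- lambda * t) / (4 * c) * (a * bessel_B (w * ((c * t)\<^sup>2 - y\<^sup>2))
            + w * (2 * c\<^sup>2 * t) * bessel_B' (w * ((c * t)\<^sup>2 - y\<^sup>2)))" for y
  let ?I = "{- (c * t)..c * t}"
  have t: "0 \<le> t" using assms by simp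
  have meas [measurable]: "Y \<in> borel_measurable M" "T \<in> borel_measurable M" "N t \<in> measurable M (count_space UNIV)" "A \<in> sets borel"
    unfolding Y_def[abs_def] T_def using t A by (auto intro: snd_position_measurable vertical_time_measurable N_measurable)
  show ev: "{\<omega> \<in> space M. snd (position c (direction J0 N \<xi>) t \<omega>) \<in> A \<and> vertical_time (direction J0 N \<xi>) t \<omega> = t} \<in> events"
    unfolding Y_def[symmetric] T_def[symmetric] by measurable
  have [measurable]: "Measurable.pred M (\<lambda>\<omega>. N t \<omega> \<in> {1..})"
    by (rule measurable_compose[OF meas(3)]) simp
  have E: "E \<in> events" unfolding E_def by measurable
  have a: "0 \<le> a" using rate_pos pq_le_1 by (simp add: a_def)
  have Gc: "continuous_on S G" for S
    unfolding G_def by (intro continuous_intros)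
  have int: "set_integrable lborel ?I (\<lambda>y. G y * h y)" if "continuous_on ?I h" for h
    using that by (intro borel_integrable_atLeastAtMost' continuous_intros Gc)
  have G0: "0 \<le> G y" if "y \<in> ?I" for y
  proof -
    have "y\<^sup>2 \<le> (c * t)\<^sup>2" using that by (intro abs_le_square_iff[THEN iffD1]) auto
    then have "0 \<le> w * ((c * t)\<^sup>2 - y\<^sup>2)" by (simp add: w_def)
    then show ?thesis
      unfolding G_def using assms(1,2) a bessel_B_nonneg bessel_B'_nonneg by (simp add: w_def)
  qed
  have "prob {\<omega> \<in> E. Y \<omega> \<in> A} = (LINT y:A|lborel. indicator ?I y * G y)"
  proof (rule sub_density_from_char[OF meas(1) E _ _ _ A(1)])
    show "integrable lborel (\<lambda>y. indicator ?I y * G y)"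
      using int[of "\<lambda>_. 1"] by (simp add: set_integrable_def)
    show "0 \<le> indicator ?I y * G y" for y using G0 by (auto simp: indicator_def)
    fix \<beta>
    have c: "(LINT y|lborel. indicator ?I y * (G y * cos (\<beta> * y)))
       = exp (- lambda * t) / 2 * (cosh_root (t\<^sup>2 * (a\<^sup>2 - (\<beta> * c)\<^sup>2)) + a * t * sinhc_root (t\<^sup>2 * (a\<^sup>2 - (\<beta> * c)\<^sup>2))
        - cos (\<beta> * c * t))"
    proof -
      have "(LINT y|lborel. indicator ?I y * (G y * cos (\<beta> * y)))
        = (LINT y:?I|lborel. exp (- lambda * t) / (4 * c) * ((a * bessel_B (w * ((c * t)\<^sup>2 - y\<^sup>2))
            + w * (2 * c\<^sup>2 * t) * bessel_B' (w * ((c * t)\<^sup>2 - y\<^sup>2))) * cos (\<beta> * y)))"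
        unfolding G_def set_lebesgue_integral_def by (simp only: mult.assoc real_scaleR_def)
      also have "\<dots> = exp (- lambda * t) / (4 * c) * (2 * c * (cosh_root (t\<^sup>2 * (a\<^sup>2 - (\<beta> * c)\<^sup>2)) + a * t * sinhc_root (t\<^sup>2 * (a\<^sup>2 - (\<beta> * c)\<^sup>2))
        - cos (\<beta> * c * t)))"
        unfolding set_integral_mult_right integral_telegraph_density[OF assms(1,2), of a \<beta>, folded w_def] ..
      also have "e / (4 * c) * (2 * c * z) = e / 2 * z" for e z
        using assms(1) by simp
      finally show ?thesis .
    qed
    \<comment> \<open>\<open>G\<close> is even in y, so its sine transform vanishes; the transform
      of the displacement is likewise real.\<close>
    have s: "(LINT y|lborel. indicator ?I y * (G y * sin (\<beta> * y))) = 0"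
      by (rule lborel_integral_odd) (auto simp: G_def indicator_def)
    have ints: "integrable lborel (\<lambda>y. indicator ?I y * (G y * cos (\<beta> * y)))"
      "integrable lborel (\<lambda>y. indicator ?I y * (G y * sin (\<beta> * y)))"
      using int[of "\<lambda>y. cos (\<beta> * y)"] int[of "\<lambda>y. sin (\<beta> * y)"]
      by (simp_all add: set_integrable_def continuous_on_cos continuous_on_sin continuous_intros)
    have "(LINT y|lborel. exp (\<i> * complex_of_real (\<beta> * y)) * complex_of_real (indicator ?I y * G y))
      = (LINT y|lborel. complex_of_real (indicator ?I y * (G y * cos (\<beta> * y))) + \<i> * complex_of_real (indicator ?I y * (G y * sin (\<beta> * y))))"
    proof (intro Bochner_Integration.integral_cong refl)
      fix y
      have e: "exp (\<i> * complex_of_real (\<beta> * y)) = of_real (cos (\<beta> * y)) + \<i> * of_real (sin (\<beta> * y))"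
        by (simp only: exp_Euler cos_of_real sin_of_real)
      show "exp (\<i> * complex_of_real (\<beta> * y)) * complex_of_real (indicator ?I y * G y)
        = complex_of_real (indicator ?I y * (G y * cos (\<beta> * y))) + \<i> * complex_of_real (indicator ?I y * (G y * sin (\<beta> * y)))"
        unfolding e by (simp only: of_real_mult distrib_left distrib_right mult_ac)
    qed
    also have "\<dots> = of_real (LINT y|lborel. indicator ?I y * (G y * cos (\<beta> * y)))
        + \<i> * of_real (LINT y|lborel. indicator ?I y * (G y * sin (\<beta> * y)))"
      using ints by (subst Bochner_Integration.integral_add) (auto simp del: of_real_mult)
    finally show "(LINT \<omega>|M. exp (\<i> * complex_of_real (\<beta> * Y \<omega>)) * indicator E \<omega>)
        = (LINT y|lborel. exp (\<i> * complex_of_real (\<beta> * y)) * complex_of_real (indicator ?I y * G y))"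
      unfolding c s E_def Y_def T_def char_vertical_moved[OF assms(2)] a_def by simp
  qed
  also have "\<dots> = (LINT y:A|lborel. G y)"
    using A by (intro set_lebesgue_integral_cong) (auto simp: indicator_def)
  \<comment> \<open>Almost surely, a vertical path without Poisson events ends at c t or -c t,
    outside \<open>A\<close>; so requiring at least one event changes the set only by a null
    set.\<close>
  also have "prob {\<omega> \<in> E. Y \<omega> \<in> A} = prob {\<omega> \<in> space M. Y \<omega> \<in> A \<and> T \<omega> = t}"
  proof (rule finite_measure_eq_AE)
    show "AE \<omega> in M. \<omega> \<in> {\<omega> \<in> E. Y \<omega> \<in> A} \<longleftrightarrow> \<omega> \<in> {\<omega> \<in> space M. Y \<omega> \<in> A \<and> T \<omega> = t}"
      using AE_always_vertical_iff[OF assms(2)] AE_space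
    proof eventually_elim
      case (elim \<omega>)
      have "N t \<omega> \<noteq> 0" if Tt: "T \<omega> = t" and YA: "Y \<omega> \<in> A"
      proof
        assume N0: "N t \<omega> = 0"
        obtain j where j: "j = 1 \<or> j = 3" "\<omega> \<in> always_reflected j (N t \<omega>)"
          using elim(1) Tt unfolding T_def by blast
        have "sin (pi * 3 / 2) = - 1" using sin_add[of pi "pi / 2"] by (simp add: field_simps)
        then have "Y \<omega> = c * t \<or> Y \<omega> = - (c * t)"
          using snd_position_always_reflected[OF j(2), of c] j(1) alternating_integral_no_event[OF elim(2) N0 t]
          by (auto simp: Y_def)
        then show False using YA A(2) by auto
      qed
      then show ?case using elim(2) by (auto simp: E_def)
    qed
    show "{\<omega> \<in> E. Y \<omega> \<in> A} \<in> events" using E unfolding E_def by measurable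
  qed (use ev in \<open>simp add: Y_def T_def\<close>)
  finally show "prob {\<omega> \<in> space M. snd (position c (direction J0 N \<xi>) t \<omega>) \<in> A \<and> vertical_time (direction J0 N \<xi>) t \<omega> = t}
      = (LINT y:A|lborel. exp (- lambda * t) / (4 * c) * (a * bessel_B (w * ((c * t)\<^sup>2 - y\<^sup>2))
            + w * (2 * c\<^sup>2 * t) * bessel_B' (w * ((c * t)\<^sup>2 - y\<^sup>2))))"
    unfolding Y_def T_def G_def .
qed

end

text \<open>The exponential formula has removable singularities where the root is zero. Division by
  zero yields zero in the logic, so at these frequencies the literal right-hand side is a wrong
  value; the limit expresses the intended one.\<close>

theorem mainTheorem16:
  fixes M :: "'a measure" and N :: "real \<Rightarrow> 'a \<Rightarrow> nat"
    and J0 :: "'a \<Rightarrow> int" and \<xi> :: "nat \<Rightarrow> 'a \<Rightarrow> int"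
    and D :: "real \<Rightarrow> 'a \<Rightarrow> real \<times> real" and Y T :: "real \<Rightarrow> 'a \<Rightarrow> real"
    and lambda p q c t :: real
  assumes motion: "turning_motion M N lambda J0 \<xi> p q"
    and "p + q < 1" and "c > 0" and "t > 0"
  defines "D \<equiv> direction J0 N \<xi>"
    and "Y \<equiv> (\<lambda>s \<omega>. snd (position c D s \<omega>))"
    and "T \<equiv> vertical_time D"
  shows
    "prob_space.joint_density_on M (Y t) (\<lambda>\<omega>. T t \<omega> = t) {- (c * t) <..< c * t}
       (\<lambda>y. exp (- lambda * t) / (4 * c) *
          (lambda * (1 - p - q) *
             bessel_I 0 (lambda / c * (1 - p - q) * sqrt (c\<^sup>2 * t\<^sup>2 - y\<^sup>2))
           + deriv (\<lambda>s. bessel_I 0 (lambda / c * (1 - p - q) * sqrt (c\<^sup>2 * s\<^sup>2 - y\<^sup>2))) t))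
     \<and>
     (let charfun = (\<lambda>\<beta> :: real. LINT \<omega>|M.
            exp (\<i> * complex_of_real (\<beta> * Y t \<omega>)) * indicator {\<omega>. T t \<omega> = t} \<omega>);
          r = complex_of_real (lambda * (1 - p - q));
          root = (\<lambda>\<beta> :: real. csqrt (complex_of_real (lambda\<^sup>2 * (1 - p - q)\<^sup>2 - \<beta>\<^sup>2 * c\<^sup>2)));
          rhs = (\<lambda>\<beta> :: real. complex_of_real (exp (- lambda * t) / 4) *
            ((1 + r / root \<beta>) * exp (of_real t * root \<beta>)
           + (1 - r / root \<beta>) * exp (- of_real t * root \<beta>)))
      in (\<forall>\<beta>. root \<beta> \<noteq> 0 \<longrightarrow> charfun \<beta> = rhs \<beta>)
       \<and> (\<forall>\<beta>. root \<beta> = 0 \<longrightarrow> (rhs \<longlongrightarrow> charfun \<beta>) (at \<beta>)))"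
proof -
  interpret turning_motion M N lambda J0 \<xi> p q by (rule motion)
  define a where "a = lambda * (1 - p - q)"
  define w where "w = (a / (2 * c))\<^sup>2"
  define G where "G y = exp (- lambda * t) / (4 * c) * (a * bessel_B (w * ((c * t)\<^sup>2 - y\<^sup>2))
            + w * (2 * c\<^sup>2 * t) * bessel_B' (w * ((c * t)\<^sup>2 - y\<^sup>2)))" for y
  define g where "g y = exp (- lambda * t) / (4 * c) *
          (lambda * (1 - p - q) *
             bessel_I 0 (lambda / c * (1 - p - q) * sqrt (c\<^sup>2 * t\<^sup>2 - y\<^sup>2))
           + deriv (\<lambda>s. bessel_I 0 (lambda / c * (1 - p - q) * sqrt (c\<^sup>2 * s\<^sup>2 - y\<^sup>2))) t)" for y
  have w: "(lambda / c * (1 - p - q) / 2)\<^sup>2 = w" by (simp add: w_def a_def mult.commute)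
  have gG: "g y = G y" if "\<bar>y\<bar> < c * t" for y
    unfolding g_def G_def bessel_I_deriv[OF that] w a_def ..
  have density: "joint_density_on (Y t) (\<lambda>\<omega>. T t \<omega> = t) {- (c * t)<..<c * t} g"
    unfolding joint_density_on_def
  proof (intro conjI ballI impI)
    \<comment> \<open>\<open>G\<close> is continuous on the closed interval and hence integrable
      there; \<open>g\<close> is known to agree with it only inside, where the derivative of the
      square-root form is under control.\<close>
    have "set_integrable lborel {- (c * t)..c * t} G"
      unfolding G_def by (intro borel_integrable_atLeastAtMost' continuous_intros)
    then have "set_integrable lborel {- (c * t)<..<c * t} G"
      by (rule set_integrable_subset) auto
    also have "?this \<longleftrightarrow> set_integrable lborel {- (c * t)<..<c * t} g"
      using gG by (intro set_integrable_cong) auto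
    finally show "set_integrable lborel {- (c * t)<..<c * t} g" .
    fix A :: "real set" assume A: "A \<in> sets borel" "A \<subseteq> {- (c * t)<..<c * t}"
    note dens = joint_density_vertical[OF \<open>c > 0\<close> \<open>t > 0\<close> A, folded a_def, folded w_def, folded G_def D_def]
    show "{\<omega> \<in> space M. Y t \<omega> \<in> A \<and> T t \<omega> = t} \<in> events"
      unfolding Y_def T_def by (rule dens(1))
    have "prob {\<omega> \<in> space M. Y t \<omega> \<in> A \<and> T t \<omega> = t} = (LINT y:A|lborel. G y)"
      unfolding Y_def T_def by (rule dens(2))
    also have "\<dots> = (LINT y:A|lborel. g y)"
      using A gG by (intro set_lebesgue_integral_cong) (auto simp: subset_eq)
    finally show "prob {\<omega> \<in> space M. Y t \<omega> \<in> A \<and> T t \<omega> = t} = (LINT y:A|lborel. g y)" .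
  qed
  define charfun where "charfun \<beta> = (LINT \<omega>|M. exp (\<i> * complex_of_real (\<beta> * Y t \<omega>)) * indicator {\<omega>. T t \<omega> = t} \<omega>)" for \<beta> :: real
  define root where "root \<beta> = csqrt (complex_of_real (lambda\<^sup>2 * (1 - p - q)\<^sup>2 - \<beta>\<^sup>2 * c\<^sup>2))" for \<beta> :: real
  define rhs where "rhs \<beta> = complex_of_real (exp (- lambda * t) / 4) *
            ((1 + complex_of_real (lambda * (1 - p - q)) / root \<beta>) * exp (of_real t * root \<beta>)
           + (1 - complex_of_real (lambda * (1 - p - q)) / root \<beta>) * exp (- of_real t * root \<beta>))" for \<beta>
  \<comment> \<open>The continuous real function that equals the characteristic function everywhere
    and the exponential formula wherever the root is nonzero.\<close>
  define \<Phi> where "\<Phi> \<beta> = exp (- lambda * t) / 2 * (cosh_root (t\<^sup>2 * (a\<^sup>2 - (\<beta> * c)\<^sup>2))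
      + a * t * sinhc_root (t\<^sup>2 * (a\<^sup>2 - (\<beta> * c)\<^sup>2)))" for \<beta>
  have char: "charfun \<beta> = of_real (\<Phi> \<beta>)" for \<beta>
  proof -
    have "charfun \<beta> = (LINT \<omega>|M. exp (\<i> * complex_of_real (\<beta> * snd (position c (direction J0 N \<xi>) t \<omega>)))
        * indicator {\<omega> \<in> space M. vertical_time (direction J0 N \<xi>) t \<omega> = t} \<omega>)"
      unfolding charfun_def Y_def T_def D_def
      by (intro Bochner_Integration.integral_cong) (auto simp: indicator_def)
    then show ?thesis unfolding char_vertical[OF \<open>t > 0\<close>] \<Phi>_def a_def .
  qed
  have rhs: "rhs \<beta> = of_real (\<Phi> \<beta>)" if "root \<beta> \<noteq> 0" for \<beta>
  proof -
    have "(root \<beta>)\<^sup>2 = complex_of_real (a\<^sup>2 - (\<beta> * c)\<^sup>2)"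
      by (simp add: root_def a_def power_mult_distrib)
    from cosh_sinhc_root_exp[OF this that, of a t] show ?thesis
      unfolding rhs_def a_def[symmetric] by (simp add: \<Phi>_def)
  qed
  have lim: "(rhs \<longlongrightarrow> charfun \<beta>) (at \<beta>)" for \<beta>
  proof (rule Lim_transform_eventually)
    have "continuous_on UNIV \<Phi>" unfolding \<Phi>_def by (intro continuous_intros)
    then have "(\<Phi> \<longlongrightarrow> \<Phi> \<beta>) (at \<beta>)" by (simp add: continuous_on_def)
    then show "((\<lambda>\<beta>. of_real (\<Phi> \<beta>)) \<longlongrightarrow> charfun \<beta>) (at \<beta>)"
      unfolding char by (rule tendsto_of_real)
    \<comment> \<open>The root vanishes only at a / c and -a / c; a punctured neighbourhood avoids
      both, even when \<beta> is one of them.\<close>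
    have "eventually (\<lambda>x. x \<noteq> a / c \<and> x \<noteq> - (a / c)) (at \<beta>)"
      by (intro eventually_conj eventually_neq_at_within)
    then show "eventually (\<lambda>x. of_real (\<Phi> x) = rhs x) (at \<beta>)"
    proof eventually_elim
      case (elim x)
      have "root x \<noteq> 0"
      proof
        assume "root x = 0"
        then have "complex_of_real (lambda\<^sup>2 * (1 - p - q)\<^sup>2 - x\<^sup>2 * c\<^sup>2) = 0"
          unfolding root_def csqrt_eq_0 .
        then have "lambda\<^sup>2 * (1 - p - q)\<^sup>2 - x\<^sup>2 * c\<^sup>2 = 0" by (simp only: of_real_eq_0_iff)
        then have "(x * c)\<^sup>2 = a\<^sup>2" by (simp add: a_def power_mult_distrib)
        then have "x * c = a \<or> x * c = - a" by (simp only: power2_eq_iff)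
        then have "x = a / c \<or> x = (- a) / c" using \<open>c > 0\<close> by (metis nonzero_eq_divide_eq less_irrefl)
        then show False using elim by simp
      qed
      then show ?case by (rule rhs[symmetric])
    qed
  qed
  have "(\<forall>\<beta>. root \<beta> \<noteq> 0 \<longrightarrow> charfun \<beta> = rhs \<beta>) \<and> (\<forall>\<beta>. root \<beta> = 0 \<longrightarrow> (rhs \<longlongrightarrow> charfun \<beta>) (at \<beta>))"
    using char rhs lim by simp
  with density show ?thesis
    unfolding Let_def g_def[abs_def] charfun_def[abs_def] rhs_def[abs_def] root_def[abs_def] by (rule conjI)
qed

end
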